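(* Let $P,Q\in D_1=K[[x]][\partial]$ be monic differential operators, where $Q$ is normalized of order $\mathbf{ord}(Q)=\deg(Q)=q>0$ and $\mathbf{ord}(P)=\deg(P)=p$. Let $S$ be a Schur operator for $Q$, so that $S^{-1}QS=\partial^q$, and put $P'=S^{-1}PS$. Suppose that $P'$ has the restriction top line. Then there does not exist a non-zero polynomial $F(X,Y)=\sum_{i,j}c_{i,j}X^iY^j\in K[X,Y]$ such that $F(P,Q):=\sum_{i,j}c_{i,j}P^iQ^j=0$.
   Context: $K$ is a field of characteristic zero; $D_1=K[[x]][\partial]$ is the ring of ordinary differential operators; $\deg$ is the degree in $\partial$. An operator is monic if its leading coefficient is $1$; it is normalized if it has the form $\partial^q+a_{q-2}\partial^{q-2}+\dots$ (no $\partial^{q-1}$ term). The ring $\hat D_1^{sym}$. It consists of all formal sums $P=\sum_{s\ge 0}a_s(x)\partial^s$, $a_s\in K[[x]]$, with $\mathbf{ord}(P):=\sup_s\{s-\upsilon(a_s)\}<\infty$ ($\upsilon$ the $x$-adic valuation), with multiplication determined by $\partial a=a\partial+a'$. It contains $D_1$. Writing $a_s=\sum_i\alpha_{s,i}x^i$, the homogeneous component of order $m$ is $P_m:=\sum_{s-i=m}\alpha_{s,i}x^i\partial^s$. Put $k=q$, let $\xi$ be a primitive $k$-th root of unity, $\tilde K=K[\xi]$, and let $\hat D_1^{sym}\hat\otimes_K\tilde K$ be the same ring defined over $\tilde K$ instead of $K$. Write $\exp(c\,x*\partial):=\sum_{s\ge0}\frac{c^s}{s!}x^s\partial^s$ and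 $\delta:=\exp((-1)x*\partial)$; $\int:=\sum_{s\ge1}\frac{(-1)^{s+1}}{s!}x^s\partial^{s-1}$; $D^r:=\partial^r$ for $r\ge0$ and $D^r:=\int^{-r}$ for $r<0$; $\Gamma_l:=(x\partial)^l$; $A_i=A_{k;i}:=\exp((\xi^i-1)x*\partial)$ for $0\le i<k$ (so $A_0=1$); $B_j:=\frac1{(j-1)!}x^{j-1}\delta\partial^{j-1}$ for $j\ge1$. An HCP from $Hcpc(k)$ of order $r$ is an operator which can be written (G-form) as a finite sum $H=\bigl(\sum_{0\le i<k}\sum_{0\le l\le d_i}f_{l,i;r}\Gamma_lA_i+\sum_{0<j\le N}g_{j;r}B_j\bigr)D^r$, with $f_{l,i;r},g_{j;r}\in\tilde K$ and $g_{j;r}=0$ for $j\le -r$ if $r<0$; the coefficients are uniquely determined by $H$ ($H=0$ is allowed). Put $E(H):=\{(l,r): \exists i,\ f_{l,i;r}\ne0\}$. For an operator $H$ all of whose homogeneous components $H_r$ are HCPs from $Hcpc(k)$, put $E(H):=\bigcup_rE(H_r)$. For real $\sigma\ge0$, $\rho>0$ put $v_{\sigma,\rho}(H):=\sup\{\sigma l+\rho j:(l,j)\in E(H)\}$ ($-\infty$ if $E(H)=\emptyset$). If some point of $E(H)$ attains this supremum (and it is finite), the line $\sigma X+\rho Y=v_{\sigma,\rho}(H)$ is called the $(\sigma,\rho)$-top line of $H$. A Schur operator for $Q$ is an invertible $S\in\hat D_1^{sym}$ with $\mathbf{ord}(S)=0$, $S_0=1$ and $S^{-1}QS=\partial^q$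 (such $S$ exists). It is a known fact that all homogeneous components of $P'=S^{-1}PS$ are HCPs from $Hcpc(q)$, so that $E(P')$ is defined, and $\mathbf{ord}(P')=p$. Restriction top line: $P'$ (of order $p$) has the restriction top line if for some real $\sigma\ge0$, $\rho>0$ the $(\sigma,\rho)$-top line of $P'$ passes through $(0,p)\in E(P')$ and contains at least two points of $E(P')$. *)

theory Defs
  imports
    "HOL-Computational_Algebra.Computational_Algebra"
    "HOL-Library.Extended_Real"
begin

section \<open>The ring of formal differential operators of bounded order\<close>

text \<open>
  A formal sum \<open>\<Sum>s. a s * \<partial>^s\<close> is given by its coefficient sequence \<open>a\<close>.
  Its order is the supremum of \<open>s - v (a s)\<close>; the zero coefficients have valuation
  \<open>\<infinity>\<close> and are therefore left out (\<open>subdegree 0 = 0\<close> is not the valuation of \<open>0\<close>).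
  The order of \<open>0\<close> is \<open>-\<infinity>\<close>.
\<close>

definition coeffs_ord :: "(nat \<Rightarrow> 'a::zero fps) \<Rightarrow> ereal" where
  "coeffs_ord a = (SUP s \<in> {s. a s \<noteq> 0}. ereal (real s - real (subdegree (a s))))"

lemma coeffs_ord_le_iff:
  "coeffs_ord a \<le> ereal M \<longleftrightarrow> (\<forall>s i. a s $ i \<noteq> 0 \<longrightarrow> real s - real i \<le> M)"
proof
  assume L: "coeffs_ord a \<le> ereal M"
  show "\<forall>s i. a s $ i \<noteq> 0 \<longrightarrow> real s - real i \<le> M"
  proof (intro allI impI)
    fix s i assume nz: "a s $ i \<noteq> 0"
    then have "a s \<noteq> 0" by auto
    then have "ereal (real s - real (subdegree (a s))) \<le> ereal M"
      using L unfolding coeffs_ord_def SUP_le_iff by auto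
    moreover have "subdegree (a s) \<le> i" using nz by (rule subdegree_leI)
    ultimately show "real s - real i \<le> M" by simp
  qed
next
  assume "\<forall>s i. a s $ i \<noteq> 0 \<longrightarrow> real s - real i \<le> M"
  then show "coeffs_ord a \<le> ereal M"
    unfolding coeffs_ord_def SUP_le_iff by auto
qed

lemma coeffs_ord_finite_iff:
  "coeffs_ord a < \<infinity> \<longleftrightarrow> (\<exists>M::nat. \<forall>s i. a s $ i \<noteq> 0 \<longrightarrow> s \<le> i + M)"
proof
  assume "coeffs_ord a < \<infinity>"
  then obtain M where "coeffs_ord a \<le> ereal M"
    by (cases "coeffs_ord a") auto
  then have *: "\<forall>s i. a s $ i \<noteq> 0 \<longrightarrow> real s - real i \<le> M"
    by (simp add: coeffs_ord_le_iff)
  have "s \<le> i + nat \<lceil>M\<rceil>" if "a s $ i \<noteq> 0" for s i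
  proof -
    have "real s - real i \<le> M" using * that by auto
    then show ?thesis by linarith
  qed
  then show "\<exists>M::nat. \<forall>s i. a s $ i \<noteq> 0 \<longrightarrow> s \<le> i + M" by blast
next
  assume "\<exists>M::nat. \<forall>s i. a s $ i \<noteq> 0 \<longrightarrow> s \<le> i + M"
  then obtain M :: nat where "\<forall>s i. a s $ i \<noteq> 0 \<longrightarrow> s \<le> i + M" by blast
  then have "coeffs_ord a \<le> ereal (real M)"
    unfolding coeffs_ord_le_iff by (fastforce simp: diff_le_eq simp flip: of_nat_add)
  also have "ereal (real M) < \<infinity>" by simp
  finally show "coeffs_ord a < \<infinity>" .
qed

typedef (overloaded) 'a dsym = "{a :: nat \<Rightarrow> 'a::field_char_0 fps. coeffs_ord a < \<infinity>}"
  morphisms dsym_coeff Abs_dsym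
  by (rule exI[of _ "\<lambda>_. 0"]) (simp add: coeffs_ord_def bot_ereal_def)

setup_lifting type_definition_dsym

lemma dsym_eqI: "(\<And>s. dsym_coeff P s = dsym_coeff Q s) \<Longrightarrow> P = Q"
  by (metis dsym_coeff_inject ext)

definition dsym_ord :: "'a::field_char_0 dsym \<Rightarrow> ereal" where
  "dsym_ord P = coeffs_ord (dsym_coeff P)"

lemma dsym_bounded: "\<exists>M::nat. \<forall>s i. dsym_coeff P s $ i \<noteq> 0 \<longrightarrow> s \<le> i + M"
  using dsym_coeff[of P] unfolding mem_Collect_eq coeffs_ord_finite_iff .

lemma dsym_cutoff: "\<exists>B. \<forall>s\<ge>B. \<forall>k\<le>m. dsym_coeff P s $ k = 0"
proof -
  obtain M where M: "\<forall>s i. dsym_coeff P s $ i \<noteq> 0 \<longrightarrow> s \<le> i + M" using dsym_bounded by blast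
  show ?thesis
    by (rule exI[of _ "m + M + 1"]) (use M in \<open>fastforce\<close>)
qed

instantiation dsym :: (field_char_0) ab_group_add
begin

lift_definition zero_dsym :: "'a dsym" is "\<lambda>_. 0"
  by (simp only: coeffs_ord_finite_iff) simp

lift_definition plus_dsym :: "'a dsym \<Rightarrow> 'a dsym \<Rightarrow> 'a dsym" is "\<lambda>a b s. a s + b s"
proof -
  fix a b :: "nat \<Rightarrow> 'a fps"
  assume "coeffs_ord a < \<infinity>" "coeffs_ord b < \<infinity>"
  then obtain M N :: nat where
    M: "\<forall>s i. a s $ i \<noteq> 0 \<longrightarrow> s \<le> i + M" and N: "\<forall>s i. b s $ i \<noteq> 0 \<longrightarrow> s \<le> i + N"
    unfolding coeffs_ord_finite_iff by blast
  have "s \<le> i + max M N" if "(a s + b s) $ i \<noteq> 0" for s i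
  proof -
    have "a s $ i \<noteq> 0 \<or> b s $ i \<noteq> 0" using that by auto
    then show ?thesis using M N by fastforce
  qed
  then show "coeffs_ord (\<lambda>s. a s + b s) < \<infinity>" unfolding coeffs_ord_finite_iff by blast
qed

lift_definition uminus_dsym :: "'a dsym \<Rightarrow> 'a dsym" is "\<lambda>a s. - a s"
  by (simp only: coeffs_ord_finite_iff) simp

definition minus_dsym :: "'a dsym \<Rightarrow> 'a dsym \<Rightarrow> 'a dsym" where
  "minus_dsym P Q = P + - Q"

instance
proof
  fix P Q R :: "'a dsym"
  show "P + Q + R = P + (Q + R)" by transfer (simp add: add.assoc)
  show "P + Q = Q + P" by transfer (simp add: add.commute)
  show "0 + P = P" by transfer simp
  show "- P + P = 0" by transfer simp
  show "P - Q = P + - Q" by (simp add: minus_dsym_def)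
qed

end

text \<open>
  From \<open>\<partial>^s b = (\<Sum>i\<le>s. (s choose i) b^(i) \<partial>^(s-i))\<close>, the coefficient of \<open>\<partial>^n\<close> in
  \<open>(\<Sum>s. a s \<partial>^s) (\<Sum>t. b t \<partial>^t)\<close> collects the terms with \<open>s = i + j\<close>, \<open>t = n - j\<close>.
  The series over \<open>i\<close> converges in the \<open>x\<close>-adic topology of the formal power series.
\<close>

definition coeffs_times ::
    "(nat \<Rightarrow> 'a::field_char_0 fps) \<Rightarrow> (nat \<Rightarrow> 'a fps) \<Rightarrow> nat \<Rightarrow> 'a fps" where
  "coeffs_times a b n =
     (\<Sum>j\<le>n. \<Sum>i. of_nat ((i + j) choose i) * a (i + j) * fps_nth_deriv i (b (n - j)))"

lemma fps_sums_nth: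
  fixes f :: "nat \<Rightarrow> 'a::field_char_0 fps"
  assumes ex: "\<And>k. \<exists>B. \<forall>i\<ge>B. f i $ k = 0" and B: "\<forall>i\<ge>B. f i $ m = 0"
  shows "(\<Sum>i. f i) $ m = (\<Sum>i<B. f i $ m)"
proof -
  obtain C where C: "\<And>k i. i \<ge> C k \<Longrightarrow> f i $ k = 0" using ex by metis
  define S where "S = Abs_fps (\<lambda>k. \<Sum>i<C k. f i $ k)"
  have "f sums S" unfolding sums_def
  proof (rule tendsto_fpsI)
    fix k
    have "(\<Sum>i<n. f i) $ k = S $ k" if "n \<ge> C k" for n
      unfolding S_def fps_sum_nth fps_nth_Abs_fps using that C
      by (intro sum.mono_neutral_right) (auto simp: not_less)
    then show "eventually (\<lambda>n. (\<Sum>i<n. f i) $ k = S $ k) sequentially"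
      by (auto simp: eventually_sequentially)
  qed
  then have "(\<Sum>i. f i) $ m = S $ m" by (simp add: sums_iff)
  also have "\<dots> = (\<Sum>i<C m. f i $ m)" by (simp add: S_def)
  also have "\<dots> = (\<Sum>i<max B (C m). f i $ m)"
    using C by (intro sum.mono_neutral_left) (auto simp: not_less)
  also have "\<dots> = (\<Sum>i<B. f i $ m)"
    using B by (intro sum.mono_neutral_right) (auto simp: not_less)
  finally show ?thesis .
qed

lemma fps_mult_nth_zero:
  fixes f g :: "'a::comm_ring_1 fps"
  assumes "\<forall>k\<le>m. f $ k = 0" shows "(f * g) $ m = 0"
  using assms by (simp add: fps_mult_nth)

lemma fps_mult_nth_cong:
  fixes f g :: "'a::comm_ring_1 fps"
  assumes "\<forall>k\<le>m. f $ k = f' $ k" "\<forall>k\<le>m. g $ k = g' $ k"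
  shows "(f * g) $ m = (f' * g') $ m"
  using assms by (simp add: fps_mult_nth)

lemma fps_nth_deriv_nth_cong:
  fixes f g :: "'a::field_char_0 fps"
  assumes "\<forall>k\<le>m + i. f $ k = g $ k"
  shows "\<forall>k\<le>m. fps_nth_deriv i f $ k = fps_nth_deriv i g $ k"
  using assms by (induction i arbitrary: f g) (auto)

lemma coeffs_times_nth:
  fixes a b :: "nat \<Rightarrow> 'a::field_char_0 fps"
  assumes ex: "\<And>m. \<exists>B. \<forall>s\<ge>B. \<forall>k\<le>m. a s $ k = 0" and B: "\<forall>s\<ge>B. \<forall>k\<le>m. a s $ k = 0"
  shows "coeffs_times a b n $ m =
    (\<Sum>j\<le>n. \<Sum>i<B. (of_nat ((i + j) choose i) * a (i + j) * fps_nth_deriv i (b (n - j))) $ m)"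
proof -
  have z: "(of_nat ((i + j) choose i) * a (i + j) * fps_nth_deriv i (b (n - j))) $ k = 0"
    if "\<forall>l\<le>k. a (i + j) $ l = 0" for i j k
    using fps_mult_nth_zero[OF that] by (simp add: mult.assoc)
  have "\<exists>C. \<forall>i\<ge>C. (of_nat ((i + j) choose i) * a (i + j) * fps_nth_deriv i (b (n - j))) $ k = 0" for j k
  proof -
    obtain C where "\<forall>s\<ge>C. \<forall>l\<le>k. a s $ l = 0" using ex by blast
    then show ?thesis by (intro exI[of _ C] allI impI z) (auto)
  qed
  then show ?thesis
    unfolding coeffs_times_def fps_sum_nth
    by (intro sum.cong refl fps_sums_nth) (use B z in auto)
qed


text \<open>The action on power series, which is faithful and turns products into compositions.\<close>

definition dsym_act :: "'a::field_char_0 dsym \<Rightarrow> 'a fps \<Rightarrow> 'a fps" where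
  "dsym_act P f = (\<Sum>s. dsym_coeff P s * fps_nth_deriv s f)"

lemma dsym_act_nth:
  assumes B: "\<forall>s\<ge>B. \<forall>k\<le>m. dsym_coeff P s $ k = 0"
  shows "dsym_act P f $ m = (\<Sum>s<B. (dsym_coeff P s * fps_nth_deriv s f) $ m)"
  unfolding dsym_act_def
proof (rule fps_sums_nth)
  fix k
  obtain C where "\<forall>s\<ge>C. \<forall>l\<le>k. dsym_coeff P s $ l = 0" using dsym_cutoff by blast
  then show "\<exists>C. \<forall>s\<ge>C. (dsym_coeff P s * fps_nth_deriv s f) $ k = 0"
    by (blast intro: fps_mult_nth_zero)
qed (use B in \<open>blast intro: fps_mult_nth_zero\<close>)

lemma dsym_act_cong:
  "\<exists>N. \<forall>f g. (\<forall>k<N. f $ k = g $ k) \<longrightarrow> dsym_act P f $ m = dsym_act P g $ m"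
proof -
  obtain B where B: "\<forall>s\<ge>B. \<forall>k\<le>m. dsym_coeff P s $ k = 0" using dsym_cutoff by blast
  have "dsym_act P f $ m = dsym_act P g $ m" if "\<forall>k<m + B + 1. f $ k = g $ k" for f g
    unfolding dsym_act_nth[OF B]
  proof (intro sum.cong refl fps_mult_nth_cong fps_nth_deriv_nth_cong)
    fix s assume "s \<in> {..<B}"
    then show "\<forall>k\<le>m + s. f $ k = g $ k" using that by auto
  qed auto
  then show ?thesis by blast
qed

lemma dsym_act_add_left: "dsym_act (P + Q) f = dsym_act P f + dsym_act Q f"
proof (rule fps_ext)
  fix m
  obtain B where B: "\<forall>s\<ge>B. \<forall>k\<le>m. dsym_coeff P s $ k = 0" using dsym_cutoff by blast
  obtain C where C: "\<forall>s\<ge>C. \<forall>k\<le>m. dsym_coeff Q s $ k = 0" using dsym_cutoff by blast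
  define D where "D = max B C"
  have D: "\<forall>s\<ge>D. \<forall>k\<le>m. dsym_coeff P s $ k = 0" "\<forall>s\<ge>D. \<forall>k\<le>m. dsym_coeff Q s $ k = 0"
    "\<forall>s\<ge>D. \<forall>k\<le>m. dsym_coeff (P + Q) s $ k = 0"
    using B C by (auto simp: D_def plus_dsym.rep_eq)
  show "dsym_act (P + Q) f $ m = (dsym_act P f + dsym_act Q f) $ m"
    unfolding fps_add_nth D(1,2)[THEN dsym_act_nth] D(3)[THEN dsym_act_nth]
    by (simp add: plus_dsym.rep_eq ring_distribs sum.distrib)
qed

lemma dsym_act_add_right: "dsym_act P (f + g) = dsym_act P f + dsym_act P g"
proof (rule fps_ext)
  fix m
  obtain B where B: "\<forall>s\<ge>B. \<forall>k\<le>m. dsym_coeff P s $ k = 0" using dsym_cutoff by blast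
  show "dsym_act P (f + g) $ m = (dsym_act P f + dsym_act P g) $ m"
    unfolding fps_add_nth B[THEN dsym_act_nth] by (simp add: ring_distribs sum.distrib)
qed

lemma dsym_act_uminus: "dsym_act (- P) f = - dsym_act P f"
proof -
  have "dsym_act (- P) f + dsym_act P f = dsym_act 0 f" by (simp flip: dsym_act_add_left)
  also have "\<dots> = 0" by (simp add: dsym_act_def zero_dsym.rep_eq)
  finally show ?thesis by (simp add: eq_neg_iff_add_eq_0)
qed

lemma fps_nth_deriv_X_power:
  "fps_nth_deriv s (fps_X ^ n :: 'a::field_char_0 fps) $ k =
    (if k + s = n then fact n / fact k else 0)"
proof (induction s arbitrary: n k)
  case (Suc s)
  have "fps_nth_deriv (Suc s) (fps_X ^ n :: 'a fps) $ k
      = of_nat (k + 1) * fps_nth_deriv s (fps_X ^ n) $ (k + 1)"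
    by (simp add: fps_nth_deriv_commute del: fps_nth_deriv.simps)
  also have "\<dots> = (if k + Suc s = n then fact n / fact k else 0)"
    using of_nat_neq_0[of k, where 'a = 'a] by (subst Suc.IH) simp
  finally show ?case .
qed (auto)

lemma dsym_act_eq_0:
  assumes "\<And>f. dsym_act P f = 0"
  shows "P = 0"
proof (rule dsym_eqI)
  fix s
  have "dsym_coeff P s = 0"
  proof (induction s rule: less_induct)
    case (less n)
    show ?case
    proof (rule fps_ext)
      fix m
      obtain B where B: "\<forall>s\<ge>B. \<forall>k\<le>m. dsym_coeff P s $ k = 0" using dsym_cutoff by blast
      have B': "\<forall>s\<ge>max B (Suc n). \<forall>k\<le>m. dsym_coeff P s $ k = 0" using B by auto
      have z: "(dsym_coeff P s * fps_nth_deriv s (fps_X ^ n)) $ m = 0" if "s \<noteq> n" for s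
      proof (cases "s < n")
        case False
        then have "fps_nth_deriv s (fps_X ^ n :: 'a fps) = 0"
          using that by (intro fps_ext) (simp add: fps_nth_deriv_X_power)
        then show ?thesis by simp
      qed (simp add: less)
      have "fps_nth_deriv n (fps_X ^ n :: 'a fps) = fps_const (fact n)"
        by (intro fps_ext) (simp add: fps_nth_deriv_X_power)
      then have "dsym_coeff P n $ m * fact n = (dsym_coeff P n * fps_nth_deriv n (fps_X ^ n)) $ m"
        by simp
      also have "\<dots> = (\<Sum>s<max B (Suc n). (dsym_coeff P s * fps_nth_deriv s (fps_X ^ n)) $ m)"
        using z by (subst sum.remove[of _ n]) auto
      also have "\<dots> = 0" using assms by (simp flip: dsym_act_nth[OF B'])
      finally show "dsym_coeff P n $ m = 0 $ m" by simp
    qed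
  qed
  then show "dsym_coeff P s = dsym_coeff 0 s" by (simp add: zero_dsym.rep_eq)
qed

lemma dsym_act_eqI:
  assumes "\<And>f. dsym_act P f = dsym_act Q f"
  shows "P = Q"
proof -
  have "P + - Q = 0"
    by (rule dsym_act_eq_0) (simp add: dsym_act_add_left dsym_act_uminus assms del: add_uminus_conv_diff)
  then show ?thesis by (simp add: eq_neg_iff_add_eq_0)
qed

instantiation dsym :: (field_char_0) "{one, times}"
begin

lift_definition one_dsym :: "'a dsym" is "\<lambda>s. if s = 0 then 1 else 0"
  by (simp only: coeffs_ord_finite_iff) (rule exI[of _ 0], auto)

lift_definition times_dsym :: "'a dsym \<Rightarrow> 'a dsym \<Rightarrow> 'a dsym" is coeffs_times
proof -
  fix a b :: "nat \<Rightarrow> 'a fps"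
  assume "coeffs_ord a < \<infinity>" "coeffs_ord b < \<infinity>"
  then obtain M N :: nat where
    M: "\<forall>s i. a s $ i \<noteq> 0 \<longrightarrow> s \<le> i + M" and N: "\<forall>s i. b s $ i \<noteq> 0 \<longrightarrow> s \<le> i + N"
    unfolding coeffs_ord_finite_iff by blast
  have cut: "\<forall>s\<ge>m + M + 1. \<forall>k\<le>m. a s $ k = 0" for m
    using M by fastforce
  then have ex: "\<exists>B. \<forall>s\<ge>B. \<forall>k\<le>m. a s $ k = 0" for m
    by blast
  have D: "fps_nth_deriv i (b t) $ v = 0" if "v + i + N < t" for i t v
  proof -
    have "\<forall>k\<le>v + i. b t $ k = 0 $ k" using N that by fastforce
    from fps_nth_deriv_nth_cong[OF this] show ?thesis by simp
  qed
  have "n \<le> m + (M + N)" if "coeffs_times a b n $ m \<noteq> 0" for n m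
  proof (rule ccontr)
    assume n: "\<not> n \<le> m + (M + N)"
    have "(a (i + j) * fps_nth_deriv i (b (n - j))) $ m = 0" if "j \<le> n" for i j
      unfolding fps_mult_nth
    proof (intro sum.neutral ballI)
      fix u assume u: "u \<in> {0..m}"
      show "a (i + j) $ u * fps_nth_deriv i (b (n - j)) $ (m - u) = 0"
      proof (cases "a (i + j) $ u = 0")
        case False
        then have "i + j \<le> u + M" using M by blast
        then have "m - u + i + N < n - j" using n u that by auto
        then show ?thesis by (simp add: D)
      qed simp
    qed
    then have "coeffs_times a b n $ m = 0"
      by (subst coeffs_times_nth[OF ex cut]) (simp add: mult.assoc)
    with that show False by simp
  qed
  then show "coeffs_ord (coeffs_times a b) < \<infinity>" unfolding coeffs_ord_finite_iff by blast
qed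

instance ..

end

lemma fps_nth_deriv_mult:
  fixes f g :: "'a::field_char_0 fps"
  shows "fps_nth_deriv s (f * g) =
    (\<Sum>i\<le>s. of_nat (s choose i) * fps_nth_deriv i f * fps_nth_deriv (s - i) g)"
proof (induction s)
  case (Suc s)
  define T where "T i = fps_nth_deriv i f * fps_nth_deriv (Suc s - i) g" for i
  have step: "fps_deriv (of_nat c * fps_nth_deriv i f * fps_nth_deriv (s - i) g)
      = of_nat c * T (Suc i) + of_nat c * T i" if "i \<le> s" for i c
  proof -
    have "Suc s - i = Suc (s - i)" using that by simp
    then show ?thesis
      by (simp add: T_def algebra_simps fps_nth_deriv_commute del: fps_nth_deriv.simps)
  qed
  have "fps_nth_deriv (Suc s) (f * g) = (\<Sum>i\<le>s. of_nat (s choose i) * T (Suc i) + of_nat (s choose i) * T i)"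
    unfolding fps_nth_deriv_commute Suc.IH fps_deriv_sum by (intro sum.cong refl step) simp
  also have "\<dots> = (\<Sum>i\<le>s. of_nat (s choose i) * T (Suc i)) + (\<Sum>i\<le>Suc s. of_nat (s choose i) * T i)"
    by (simp add: sum.distrib)
  also have "\<dots> = (\<Sum>i\<le>Suc s. of_nat (Suc s choose i) * T i)"
    unfolding sum.atMost_Suc_shift by (simp add: sum.distrib algebra_simps)
  finally show ?case by (simp add: T_def mult.assoc)
qed simp

lemma dsym_act_mult: "dsym_act (P * Q) f = dsym_act P (dsym_act Q f)"
proof (rule fps_ext)
  fix m
  let ?p = "dsym_coeff P" and ?q = "dsym_coeff Q"
  obtain B where B: "\<forall>s\<ge>B. \<forall>k\<le>m. ?p s $ k = 0" using dsym_cutoff by blast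
  obtain C where C: "\<forall>s\<ge>C. \<forall>k\<le>m + B. ?q s $ k = 0" using dsym_cutoff by blast
  define c where "c s t i = of_nat (s choose i) * ?p s * fps_nth_deriv i (?q t)" for s t i
  define h where "h s t i = (c s t i * fps_nth_deriv (t + s - i) f) $ m" for s t i
  have Dq: "fps_nth_deriv i (?q t) $ k = 0" if "t \<ge> C" "i \<le> B" "k \<le> m" for t i k
  proof -
    have "\<forall>l\<le>k + i. ?q t $ l = 0 $ l" using C that by auto
    from fps_nth_deriv_nth_cong[OF this] show ?thesis by simp
  qed
  have c0: "c s t i $ k = 0" if "s \<ge> B \<or> t \<ge> C \<and> i \<le> B" "k \<le> m" for s t i k
    using that B Dq by (auto simp: c_def fps_mult_nth)
  then have h0: "h s t i = 0" if "s \<ge> B \<or> t \<ge> C \<and> i \<le> B" for s t i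
    unfolding h_def using that by (intro fps_mult_nth_zero) auto
  have PQ: "dsym_coeff (P * Q) n $ k = (\<Sum>j\<le>n. \<Sum>i<B. c (i + j) (n - j) i) $ k" if "k \<le> m" for n k
    unfolding times_dsym.rep_eq c_def fps_sum_nth
    by (rule coeffs_times_nth) (use dsym_cutoff B that in auto)
  have "dsym_coeff (P * Q) n $ k = 0" if "n \<ge> B + C" "k \<le> m" for n k
    unfolding PQ[OF that(2)] fps_sum_nth
  proof (intro sum.neutral ballI)
    fix j i assume "j \<in> {..n}" "i \<in> {..<B}"
    show "c (i + j) (n - j) i $ k = 0"
      using \<open>i \<in> _\<close> that by (cases "i + j \<ge> B") (auto intro!: c0)
  qed
  then have "dsym_act (P * Q) f $ m = (\<Sum>n<B + C. (dsym_coeff (P * Q) n * fps_nth_deriv n f) $ m)"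
    by (intro dsym_act_nth) auto
  also have "\<dots> = (\<Sum>n<B + C. ((\<Sum>j\<le>n. \<Sum>i<B. c (i + j) (n - j) i) * fps_nth_deriv n f) $ m)"
    using PQ by (intro sum.cong refl fps_mult_nth_cong) auto
  also have "\<dots> = (\<Sum>n<B + C. \<Sum>j\<le>n. \<Sum>i<B. h (i + j) (n - j) i)"
    unfolding sum_distrib_right fps_sum_nth h_def by (intro sum.cong refl) auto
  also have "\<dots> = (\<Sum>(n, j, i) \<in> (SIGMA n:{..<B + C}. {..n} \<times> {..<B}). h (i + j) (n - j) i)"
    by (simp add: sum.Sigma sum.cartesian_product)
  also have "\<dots> = (\<Sum>(s, t, i) \<in> (SIGMA s:{..<B}. {..<C} \<times> {..s}). h s t i)"
    by (rule sum.reindex_bij_witness_not_neutral[where i = "\<lambda>(s, t, i). (t + s - i, s - i, i)"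
          and j = "\<lambda>(n, j, i). (i + j, n - j, i)"
          and S' = "{(n, j, i) \<in> (SIGMA n:{..<B + C}. {..n} \<times> {..<B}). i + j \<ge> B \<or> n - j \<ge> C}"
          and T' = "{}"])
       (auto intro!: h0 intro: finite_subset[of _ "{..<B + C} \<times> {..B + C} \<times> {..<B}"])
  also have "\<dots> = (\<Sum>s<B. \<Sum>t<C. \<Sum>i\<le>s. h s t i)"
    by (simp add: sum.Sigma sum.cartesian_product)
  also have "\<dots> = (\<Sum>s<B. (?p s * fps_nth_deriv s (\<Sum>t<C. ?q t * fps_nth_deriv t f)) $ m)"
  proof (rule sum.cong)
    fix s
    have *: "fps_nth_deriv (s - i) (fps_nth_deriv t f) = fps_nth_deriv (t + s - i) f" if "i \<le> s" for t i
    proof -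
      have "fps_nth_deriv u (fps_nth_deriv t f) = fps_nth_deriv (t + u) f" for u
        by (induction u) (simp_all add: fps_nth_deriv_commute del: fps_nth_deriv.simps(2))
      from this[of "s - i"] show ?thesis using that by simp
    qed
    show "(\<Sum>t<C. \<Sum>i\<le>s. h s t i) = (?p s * fps_nth_deriv s (\<Sum>t<C. ?q t * fps_nth_deriv t f)) $ m"
      unfolding fps_nth_deriv_sum fps_nth_deriv_mult sum_distrib_left fps_sum_nth h_def c_def
      by (intro sum.cong refl) (simp add: * ac_simps)
  qed simp
  also have "\<dots> = (\<Sum>s<B. (?p s * fps_nth_deriv s (dsym_act Q f)) $ m)"
  proof (intro sum.cong refl fps_mult_nth_cong fps_nth_deriv_nth_cong allI impI)
    fix s k assume "s \<in> {..<B}" "k \<le> m + s"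
    then show "(\<Sum>t<C. ?q t * fps_nth_deriv t f) $ k = dsym_act Q f $ k"
      by (subst dsym_act_nth[of C]) (use C in \<open>auto simp: fps_sum_nth\<close>)
  qed
  also have "\<dots> = dsym_act P (dsym_act Q f) $ m"
    using dsym_act_nth[OF B] by simp
  finally show "dsym_act (P * Q) f $ m = dsym_act P (dsym_act Q f) $ m" .
qed

lemma dsym_act_1: "dsym_act 1 f = f"
proof (rule fps_ext)
  fix m
  have "dsym_act 1 f $ m = (\<Sum>s<1. (dsym_coeff 1 s * fps_nth_deriv s f) $ m)"
    by (rule dsym_act_nth) (auto simp: one_dsym.rep_eq)
  then show "dsym_act 1 f $ m = f $ m" by (simp add: one_dsym.rep_eq)
qed

instance dsym :: (field_char_0) ring_1
proof
  fix P Q R :: "'a dsym"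
  show "P * Q * R = P * (Q * R)" by (rule dsym_act_eqI) (simp add: dsym_act_mult)
  show "1 * P = P" "P * 1 = P" by (rule dsym_act_eqI; simp add: dsym_act_mult dsym_act_1)+
  show "(P + Q) * R = P * R + Q * R" "P * (Q + R) = P * Q + P * R"
    by (rule dsym_act_eqI; simp add: dsym_act_mult dsym_act_add_left dsym_act_add_right)+
  show "(0 :: 'a dsym) \<noteq> 1"
    by (metis one_dsym.rep_eq zero_dsym.rep_eq zero_neq_one)
qed

section \<open>Basic operators\<close>

lift_definition dsym_fun :: "'a::field_char_0 fps \<Rightarrow> 'a dsym" is "\<lambda>a s. if s = 0 then a else 0"
  by (simp only: coeffs_ord_finite_iff) (rule exI[of _ 0], auto)

definition dsym_const :: "'a::field_char_0 \<Rightarrow> 'a dsym" where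
  "dsym_const c = dsym_fun (fps_const c)"

definition dsym_x :: "'a::field_char_0 dsym" where
  "dsym_x = dsym_fun fps_X"

lift_definition dsym_diff :: "'a::field_char_0 dsym" is "\<lambda>s. if s = 1 then 1 else 0"
  by (simp only: coeffs_ord_finite_iff) (rule exI[of _ 1], auto)

lemma dsym_act_fun: "dsym_act (dsym_fun a) f = a * f"
proof (rule fps_ext)
  fix m
  have "dsym_act (dsym_fun a) f $ m = (\<Sum>s<1. (dsym_coeff (dsym_fun a) s * fps_nth_deriv s f) $ m)"
    by (rule dsym_act_nth) (auto simp: dsym_fun.rep_eq)
  then show "dsym_act (dsym_fun a) f $ m = (a * f) $ m" by (simp add: dsym_fun.rep_eq)
qed

lemma dsym_act_diff: "dsym_act dsym_diff f = fps_deriv f"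
proof (rule fps_ext)
  fix m
  have "dsym_act dsym_diff f $ m = (\<Sum>s<2. (dsym_coeff dsym_diff s * fps_nth_deriv s f) $ m)"
    by (rule dsym_act_nth) (auto simp: dsym_diff.rep_eq)
  then show "dsym_act dsym_diff f $ m = fps_deriv f $ m"
    by (simp add: dsym_diff.rep_eq numeral_2_eq_2)
qed

lemma dsym_diff_fun: "dsym_diff * dsym_fun a = dsym_fun a * dsym_diff + dsym_fun (fps_deriv a)"
  by (rule dsym_act_eqI)
     (simp add: dsym_act_mult dsym_act_add_left dsym_act_fun dsym_act_diff)

text \<open>Homogeneous component of order \<open>m\<close>.\<close>

lift_definition dsym_hcomp :: "'a::field_char_0 dsym \<Rightarrow> int \<Rightarrow> 'a dsym" is
  "\<lambda>a m s. Abs_fps (\<lambda>i. if int s - int i = m then a s $ i else 0)"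
  unfolding coeffs_ord_finite_iff by auto

definition dsym_invertible :: "'a::field_char_0 dsym \<Rightarrow> bool" where
  "dsym_invertible S \<longleftrightarrow> (\<exists>T. S * T = 1 \<and> T * S = 1)"

definition dsym_inv :: "'a::field_char_0 dsym \<Rightarrow> 'a dsym" where
  "dsym_inv S = (THE T. S * T = 1 \<and> T * S = 1)"

lemma dsym_inv:
  assumes "dsym_invertible S"
  shows "S * dsym_inv S = 1" "dsym_inv S * S = 1"
proof -
  obtain T where T: "S * T = 1 \<and> T * S = 1" using assms by (auto simp: dsym_invertible_def)
  have "S * dsym_inv S = 1 \<and> dsym_inv S * S = 1"
    unfolding dsym_inv_def
  proof (rule theI[of _ T], fact T)
    fix T' assume "S * T' = 1 \<and> T' * S = 1"
    then show "T' = T" using T by (metis mult.assoc mult_1_left mult_1_right)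
  qed
  then show "S * dsym_inv S = 1" "dsym_inv S * S = 1" by auto
qed

section \<open>Ordinary differential operators\<close>

definition ODO :: "'a::field_char_0 dsym set" where
  "ODO = {P. finite {s. dsym_coeff P s \<noteq> 0}}"

text \<open>The degree in \<open>\<partial>\<close>; only meaningful for nonzero elements of \<^const>\<open>ODO\<close>.\<close>

definition dsym_deg :: "'a::field_char_0 dsym \<Rightarrow> nat" where
  "dsym_deg P = Max {s. dsym_coeff P s \<noteq> 0}"

definition dsym_monic :: "'a::field_char_0 dsym \<Rightarrow> bool" where
  "dsym_monic P \<longleftrightarrow> P \<in> ODO \<and> dsym_coeff P (dsym_deg P) = 1"

definition dsym_normalized :: "'a::field_char_0 dsym \<Rightarrow> bool" where
  "dsym_normalized P \<longleftrightarrow> dsym_monic P \<and> (dsym_deg P \<ge> 1 \<longrightarrow> dsym_coeff P (dsym_deg P - 1) = 0)"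

definition schur_operator :: "'a::field_char_0 dsym \<Rightarrow> nat \<Rightarrow> 'a dsym \<Rightarrow> bool" where
  "schur_operator Q q S \<longleftrightarrow> dsym_invertible S \<and> dsym_ord S = 0 \<and> dsym_hcomp S 0 = 1 \<and>
     dsym_inv S * Q * S = dsym_diff ^ q"

text \<open>
  The outer variable of \<open>F\<close> is \<open>X\<close>, the inner one is \<open>Y\<close>:
  \<open>coeff (coeff F i) j\<close> is the coefficient of \<open>X^i Y^j\<close>.
  For non-commuting \<open>P\<close>, \<open>Q\<close> the order of the factors \<open>P^i Q^j\<close> matters.
\<close>

definition poly2_eval :: "'a::field_char_0 poly poly \<Rightarrow> 'a dsym \<Rightarrow> 'a dsym \<Rightarrow> 'a dsym" where
  "poly2_eval F P Q =
     (\<Sum>i\<le>degree F. \<Sum>j\<le>degree (coeff F i). dsym_const (coeff (coeff F i) j) * P ^ i * Q ^ j)"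

section \<open>Extension of the ground field\<close>

text \<open>
  \<open>K\<close> is the type \<open>'a\<close>, embedded by \<open>\<iota>\<close> into an extension field \<open>'b\<close> that contains a primitive
  \<open>k\<close>-th root of unity \<open>\<xi>\<close>.  The field \<open>K[\<xi>]\<close> is the subset \<open>adjoin \<iota> \<xi>\<close> of \<open>'b\<close>.
\<close>

definition field_embedding :: "('a::field \<Rightarrow> 'b::field) \<Rightarrow> bool" where
  "field_embedding \<iota> \<longleftrightarrow> \<iota> 1 = 1 \<and> (\<forall>x y. \<iota> (x + y) = \<iota> x + \<iota> y) \<and> (\<forall>x y. \<iota> (x * y) = \<iota> x * \<iota> y)"

definition primitive_root_of_unity :: "nat \<Rightarrow> 'b::field \<Rightarrow> bool" where
  "primitive_root_of_unity k \<xi> \<longleftrightarrow> k > 0 \<and> \<xi> ^ k = 1 \<and> (\<forall>j. 0 < j \<and> j < k \<longrightarrow> \<xi> ^ j \<noteq> 1)"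

definition adjoin :: "('a::field \<Rightarrow> 'b::field) \<Rightarrow> 'b \<Rightarrow> 'b set" where
  "adjoin \<iota> \<xi> = {poly (map_poly \<iota> u) \<xi> | u. True}"

definition dsym_map :: "('a::field_char_0 \<Rightarrow> 'b::field_char_0) \<Rightarrow> 'a dsym \<Rightarrow> 'b dsym" where
  "dsym_map \<iota> P = Abs_dsym (\<lambda>s. Abs_fps (\<lambda>i. \<iota> (dsym_coeff P s $ i)))"

lemma dsym_coeff_map:
  assumes "field_embedding \<iota>"
  shows "dsym_coeff (dsym_map \<iota> P) s $ i = \<iota> (dsym_coeff P s $ i)"
proof -
  have "\<iota> 0 + \<iota> 0 = \<iota> 0" using assms by (metis field_embedding_def add_0)
  then have 0: "\<iota> 0 = 0" by simp
  obtain M where "\<forall>s i. dsym_coeff P s $ i \<noteq> 0 \<longrightarrow> s \<le> i + M" using dsym_bounded by blast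
  then have "coeffs_ord (\<lambda>s. Abs_fps (\<lambda>i. \<iota> (dsym_coeff P s $ i))) < \<infinity>"
    unfolding coeffs_ord_finite_iff by (intro exI[of _ M]) (metis 0 fps_nth_Abs_fps)
  then show ?thesis by (simp add: dsym_map_def Abs_dsym_inverse)
qed

section \<open>HCPs and the sets \<open>E(H)\<close>\<close>

text \<open>\<open>exp(c x*\<partial>)\<close>, \<open>\<delta>\<close> and \<open>\<integral>\<close>; in the latter, \<open>s\<close> is the exponent of \<open>\<partial>\<close>,
  i.e. the summation index of the usual formula is \<open>s + 1\<close>.\<close>

lift_definition dsym_exp :: "'a::field_char_0 \<Rightarrow> 'a dsym" is
  "\<lambda>c s. fps_const (c ^ s / fact s) * fps_X ^ s"
  by (simp only: coeffs_ord_finite_iff) (rule exI[of _ 0], auto)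

definition dsym_delta :: "'a::field_char_0 dsym" where
  "dsym_delta = dsym_exp (- 1)"

lift_definition dsym_int :: "'a::field_char_0 dsym" is
  "\<lambda>s. fps_const ((- 1) ^ (s + 1 + 1) / fact (s + 1)) * fps_X ^ (s + 1)"
  by (simp only: coeffs_ord_finite_iff)
     (rule exI[of _ 0], auto simp: fps_X_power_nth simp del: power_Suc split: if_splits)

definition dsym_D :: "int \<Rightarrow> 'a::field_char_0 dsym" where
  "dsym_D r = (if r \<ge> 0 then dsym_diff ^ nat r else dsym_int ^ nat (- r))"

definition dsym_Gamma :: "nat \<Rightarrow> 'a::field_char_0 dsym" where
  "dsym_Gamma l = (dsym_x * dsym_diff) ^ l"

definition dsym_A :: "'a::field_char_0 \<Rightarrow> nat \<Rightarrow> 'a dsym" where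
  "dsym_A \<xi> i = dsym_exp (\<xi> ^ i - 1)"

definition dsym_B :: "nat \<Rightarrow> 'a::field_char_0 dsym" where
  "dsym_B j = dsym_const (1 / fact (j - 1)) * dsym_x ^ (j - 1) * dsym_delta * dsym_diff ^ (j - 1)"

text \<open>\<open>G_form \<iota> k \<xi> r d N f g H\<close>: the coefficients \<open>f\<close>, \<open>g\<close> give a G-form of \<open>H\<close> as an HCP
  from \<open>Hcpc(k)\<close> of order \<open>r\<close>.\<close>

definition G_form ::
    "('a::field_char_0 \<Rightarrow> 'b::field_char_0) \<Rightarrow> nat \<Rightarrow> 'b \<Rightarrow> int \<Rightarrow> (nat \<Rightarrow> nat) \<Rightarrow> nat \<Rightarrow>
     (nat \<Rightarrow> nat \<Rightarrow> 'b) \<Rightarrow> (nat \<Rightarrow> 'b) \<Rightarrow> 'b dsym \<Rightarrow> bool" where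
  "G_form \<iota> k \<xi> r d N f g H \<longleftrightarrow>
     (\<forall>l i. f l i \<in> adjoin \<iota> \<xi>) \<and> (\<forall>j. g j \<in> adjoin \<iota> \<xi>) \<and>
     (r < 0 \<longrightarrow> (\<forall>j. int j \<le> - r \<longrightarrow> g j = 0)) \<and>
     H = ((\<Sum>i<k. \<Sum>l\<le>d i. dsym_const (f l i) * dsym_Gamma l * dsym_A \<xi> i)
          + (\<Sum>j=1..N. dsym_const (g j) * dsym_B j)) * dsym_D r"

text \<open>
  As the coefficients of the G-form are determined by \<open>H\<close>, it is enough to ask for some G-form
  with a nonzero coefficient.
\<close>

definition hcp_points ::
    "('a::field_char_0 \<Rightarrow> 'b::field_char_0) \<Rightarrow> nat \<Rightarrow> 'b \<Rightarrow> int \<Rightarrow> 'b dsym \<Rightarrow> (nat \<times> int) set" where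
  "hcp_points \<iota> k \<xi> r H =
     {(l, r) | l. \<exists>d N f g i. G_form \<iota> k \<xi> r d N f g H \<and> i < k \<and> l \<le> d i \<and> f l i \<noteq> 0}"

definition dsym_E ::
    "('a::field_char_0 \<Rightarrow> 'b::field_char_0) \<Rightarrow> nat \<Rightarrow> 'b \<Rightarrow> 'b dsym \<Rightarrow> (nat \<times> int) set" where
  "dsym_E \<iota> k \<xi> H = (\<Union>r. hcp_points \<iota> k \<xi> r (dsym_hcomp H r))"

section \<open>Top lines\<close>

definition weight :: "real \<Rightarrow> real \<Rightarrow> nat \<times> int \<Rightarrow> real" where
  "weight \<sigma> \<rho> = (\<lambda>(l, j). \<sigma> * real l + \<rho> * real_of_int j)"

definition weight_sup :: "real \<Rightarrow> real \<Rightarrow> (nat \<times> int) set \<Rightarrow> ereal" where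
  "weight_sup \<sigma> \<rho> E = (SUP e \<in> E. ereal (weight \<sigma> \<rho> e))"

definition has_top_line :: "real \<Rightarrow> real \<Rightarrow> (nat \<times> int) set \<Rightarrow> bool" where
  "has_top_line \<sigma> \<rho> E \<longleftrightarrow> (\<exists>e\<in>E. ereal (weight \<sigma> \<rho> e) = weight_sup \<sigma> \<rho> E)"

text \<open>The lattice points on the top line.\<close>

definition top_line :: "real \<Rightarrow> real \<Rightarrow> (nat \<times> int) set \<Rightarrow> (nat \<times> int) set" where
  "top_line \<sigma> \<rho> E = {e. ereal (weight \<sigma> \<rho> e) = weight_sup \<sigma> \<rho> E}"

definition restriction_top_line :: "nat \<Rightarrow> (nat \<times> int) set \<Rightarrow> bool" where
  "restriction_top_line p E \<longleftrightarrow>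
     (\<exists>\<sigma> \<rho>. \<sigma> \<ge> 0 \<and> \<rho> > 0 \<and> has_top_line \<sigma> \<rho> E \<and>
        (0, int p) \<in> E \<and> (0, int p) \<in> top_line \<sigma> \<rho> E \<and>
        (\<exists>e\<in>E. \<exists>e'\<in>E. e \<noteq> e' \<and> e \<in> top_line \<sigma> \<rho> E \<and> e' \<in> top_line \<sigma> \<rho> E))"

end

theory Submission
  imports Defs
begin

text \<open>
  Conjugation by \<open>S\<close> turns a relation \<open>F(P, Q) = 0\<close> into \<open>F(P', \<partial>^q) = 0\<close>, and the latter is refuted
  by looking at its part of highest \<open>(\<sigma>, \<rho>)\<close>-weight.

  In the basis \<open>x^n / n!\<close> of power series, an operator \<open>T\<close> is a matrix whose diagonals are its
  homogeneous components: the component of order \<open>r\<close> becomes a function \<open>diag T r m\<close> of the row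
  \<open>m\<close>.  In this picture \<open>\<Gamma>_l A_i D^r\<close> is \<open>m^l \<xi>^(i m)\<close>, the \<open>B_j\<close> are functions
  with finite support, and the commutator with \<open>\<partial>^q\<close> is the difference operator
  \<open>\<Delta> h(m) = h(m + q) - h(m)\<close>.  Hence an HCP is a polynomial in \<open>m\<close> with \<open>q\<close>-periodic
  coefficients, up to finitely many values, and its points in \<open>E\<close> are detected by iterated differences.

  Degrees.  The operator \<open>ad_Q^l P\<close> has degree at most \<open>p + l (q - 1)\<close>.  Read off from its conjugate
  \<open>ad_(\<partial>^q)^l P'\<close>, this says that \<open>\<Delta>^l\<close> kills the components of \<open>P'\<close> of order \<open>r > p - l\<close>.
  So every component of \<open>P'\<close> is an HCP and has all its exponents \<open>l\<close> in \<open>E(P')\<close>; the top line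
  through \<open>(0, p)\<close> then bounds the degree of the component of order \<open>r\<close> by \<open>(p - r) / \<tau>\<close>, with
  \<open>\<tau> = \<sigma> / \<rho>\<close> (\<open>fdiff_diag_eq_0_of_points\<close>).

  Constancy on the top line.  A priori the coefficients of the terms on the top line are periodic functions,
  and for \<open>q > 1\<close> such symbols form a noncommutative ring with nilpotent elements, in which an algebraic
  relation would not be absurd.  But \<open>\<Delta>^l\<close> of the component with degree \<open>l\<close> on the top line is the
  component of highest order of \<open>ad_(\<partial>^q)^l P'\<close>.  As \<open>S_0 = 1\<close>, it is also the component of highest order of
  \<open>ad_Q^l P\<close>, a differential operator of finite degree, and hence a polynomial in \<open>m\<close>.  Being periodic
  too, it is constant (\<open>fdiff_diag_conjugate_constant\<close>).

  Symbols.  Therefore the top line of \<open>P'\<close> is described by a power series \<open>\<phi>\<close> over \<open>K\<close>, whose constant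
  term is \<open>1\<close> and which is not constant because of the second point on the line.  Symbols of this kind are
  multiplicative (\<open>has_symbol_mult\<close>), and \<open>\<partial>^q\<close> has the symbol \<open>1\<close>.  The part of highest weight of
  \<open>F(P', \<partial>^q) = 0\<close> is a nonzero polynomial over \<open>K\<close> that annihilates \<open>\<phi>\<close>, but a nonconstant power
  series is transcendental over \<open>K\<close>.
\<close>

section \<open>Matrices in the basis of divided powers\<close>

text \<open>
  The matrix of \<open>T\<close> in the basis of divided powers \<open>x^n / n!\<close>: column \<open>n\<close>, row \<open>k\<close>.  In this basis
  \<open>\<partial>\<close> and \<open>\<integral>\<close> are shifts without coefficients, and the component of order \<open>r\<close> is the
  diagonal \<open>n - k = r\<close>.  The sum is the entry read off from the coefficients of \<open>T\<close>, where the term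
  \<open>x^i \<partial>^s\<close> contributes to the diagonal \<open>s - i\<close> the falling factorial \<open>i! * (k choose i)\<close>.
\<close>

definition dmat :: "'a::field_char_0 dsym \<Rightarrow> nat \<Rightarrow> nat \<Rightarrow> 'a" where
  "dmat T n k = (\<Sum>i\<le>k. if k \<le> i + n
     then dsym_coeff T (i + n - k) $ i * (fact i * of_nat (k choose i)) else 0)"

lemma dsym_act_X_power:
  "dsym_act T (fps_X ^ n) $ k = fact n / fact k * dmat T n k"
proof -
  obtain B where B: "\<forall>s\<ge>B. \<forall>j\<le>k. dsym_coeff T s $ j = 0" using dsym_cutoff by blast
  have "dsym_act T (fps_X ^ n) $ k
      = (\<Sum>s<B. \<Sum>i\<le>k. dsym_coeff T s $ i * (if k - i + s = n then fact n / fact (k - i) else 0))"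
    unfolding dsym_act_nth[OF B] fps_mult_nth fps_nth_deriv_X_power by (simp add: atMost_atLeast0)
  also have "\<dots> = (\<Sum>i\<le>k. \<Sum>s<B. dsym_coeff T s $ i * (if k - i + s = n then fact n / fact (k - i) else 0))"
    by (rule sum.swap)
  also have "\<dots> = (\<Sum>i\<le>k. if k \<le> i + n
      then dsym_coeff T (i + n - k) $ i * (fact n / fact (k - i)) else 0)"
  proof (rule sum.cong)
    fix i assume "i \<in> {..k}"
    then have i: "i \<le> k" by simp
    have "(\<Sum>s<B. dsym_coeff T s $ i * (if k - i + s = n then fact n / fact (k - i) else 0))
        = (\<Sum>s<B. if s = i + n - k then (if k \<le> i + n then dsym_coeff T s $ i * (fact n / fact (k - i)) else 0) else 0)"
      using i by (intro sum.cong) auto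
    also have "\<dots> = (if k \<le> i + n then dsym_coeff T (i + n - k) $ i * (fact n / fact (k - i)) else 0)"
      using B i by (auto simp: sum.delta)
    finally show "(\<Sum>s<B. dsym_coeff T s $ i * (if k - i + s = n then fact n / fact (k - i) else 0))
        = (if k \<le> i + n then dsym_coeff T (i + n - k) $ i * (fact n / fact (k - i)) else 0)" .
  qed simp
  also have "\<dots> = fact n / fact k * dmat T n k"
    unfolding dmat_def sum_distrib_left
  proof (intro sum.cong refl)
    fix i assume "i \<in> {..k}"
    then have "(of_nat (k choose i) :: 'a) = fact k / (fact i * fact (k - i))"
      by (simp add: binomial_fact)
    then show "(if k \<le> i + n then dsym_coeff T (i + n - k) $ i * (fact n / fact (k - i)) else 0)
      = fact n / fact k * (if k \<le> i + n
          then dsym_coeff T (i + n - k) $ i * (fact i * of_nat (k choose i)) else 0)"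
      by (simp add: field_simps)
  qed
  finally show ?thesis .
qed

lemma dsym_act_const_mult: "dsym_act T (fps_const c * f) = fps_const c * dsym_act T f"
proof (rule fps_ext)
  fix m
  obtain B where B: "\<forall>s\<ge>B. \<forall>k\<le>m. dsym_coeff T s $ k = 0" using dsym_cutoff by blast
  have "(dsym_coeff T s * fps_nth_deriv s (fps_const c * f)) $ m
      = c * (dsym_coeff T s * fps_nth_deriv s f) $ m" for s
    by (simp add: mult.left_commute[of _ "fps_const c"])
  then show "dsym_act T (fps_const c * f) $ m = (fps_const c * dsym_act T f) $ m"
    unfolding dsym_act_nth[OF B] fps_mult_left_const_nth by (simp add: sum_distrib_left)
qed

lemma dsym_act_0: "dsym_act T 0 = 0"
  using dsym_act_add_right[of T 0 0] by simp

lemma dsym_act_sum: "dsym_act T (\<Sum>i\<in>A. f i) = (\<Sum>i\<in>A. dsym_act T (f i))"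
  by (induction A rule: infinite_finite_induct) (auto simp: dsym_act_0 dsym_act_add_right)

lemma fps_nth_truncated_sum:
  fixes f :: "'a::field_char_0 fps"
  assumes "i < B" shows "(\<Sum>n<B. fps_const (f $ n) * fps_X ^ n) $ i = f $ i"
proof -
  have "(\<Sum>n<B. fps_const (f $ n) * fps_X ^ n) $ i = (\<Sum>n<B. if n = i then f $ n else 0)"
    unfolding fps_sum_nth fps_mult_left_const_nth fps_X_power_nth by (intro sum.cong) auto
  then show ?thesis using assms by simp
qed

lemma dsym_act_nth_dmat:
  "\<exists>N. \<forall>B\<ge>N. dsym_act T f $ k = (\<Sum>n<B. f $ n * (fact n / fact k * dmat T n k))"
proof -
  obtain N where N: "\<forall>f g. (\<forall>i<N. f $ i = g $ i) \<longrightarrow> dsym_act T f $ k = dsym_act T g $ k"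
    using dsym_act_cong by blast
  have "dsym_act T f $ k = (\<Sum>n<B. f $ n * (fact n / fact k * dmat T n k))" if "B \<ge> N" for B
  proof -
    let ?g = "\<Sum>n<B. fps_const (f $ n) * fps_X ^ n"
    have "\<forall>i<N. f $ i = ?g $ i"
      using that by (intro allI impI fps_nth_truncated_sum[symmetric]) simp
    then have "dsym_act T f $ k = dsym_act T ?g $ k"
      by (rule N[THEN spec, THEN spec, THEN mp])
    also have "\<dots> = (\<Sum>n<B. f $ n * (fact n / fact k * dmat T n k))"
      unfolding dsym_act_sum dsym_act_const_mult fps_sum_nth fps_mult_left_const_nth
        dsym_act_X_power ..
    finally show ?thesis .
  qed
  then show ?thesis by blast
qed

lemma dmat_eqI:
  assumes "\<And>n k. dmat T n k = dmat U n k"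
  shows "T = U"
proof (rule dsym_act_eqI, rule fps_ext)
  fix f k
  obtain N where N: "\<forall>B\<ge>N. dsym_act T f $ k = (\<Sum>n<B. f $ n * (fact n / fact k * dmat T n k))"
    using dsym_act_nth_dmat by blast
  obtain M where M: "\<forall>B\<ge>M. dsym_act U f $ k = (\<Sum>n<B. f $ n * (fact n / fact k * dmat U n k))"
    using dsym_act_nth_dmat by blast
  show "dsym_act T f $ k = dsym_act U f $ k"
    using N[rule_format, of "max N M"] M[rule_format, of "max N M"] by (simp add: assms)
qed

lemma dmat_act: "dmat T n k = fact k / fact n * dsym_act T (fps_X ^ n) $ k"
  by (simp add: dsym_act_X_power)

text \<open>
  A row of the matrix has only finitely many nonzero entries, because the order of \<open>T\<close> is bounded;
  hence the matrix product makes sense.  The bound \<open>B\<close> is left open, since the rows that occur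
  later end at different places.
\<close>

lemma dmat_mult:
  assumes "\<And>j. j \<ge> B \<Longrightarrow> dmat T j k = 0"
  shows "dmat (T * U) n k = (\<Sum>j<B. dmat T j k * dmat U n j)"
proof -
  obtain N where N: "\<forall>C\<ge>N. dsym_act T (dsym_act U (fps_X ^ n)) $ k
      = (\<Sum>j<C. dsym_act U (fps_X ^ n) $ j * (fact j / fact k * dmat T j k))"
    using dsym_act_nth_dmat by blast
  have "dmat (T * U) n k = fact k / fact n * dsym_act T (dsym_act U (fps_X ^ n)) $ k"
    by (simp add: dmat_act dsym_act_mult)
  also have "\<dots> = fact k / fact n * (\<Sum>j<max N B. dsym_act U (fps_X ^ n) $ j * (fact j / fact k * dmat T j k))"
    using N by simp
  also have "\<dots> = (\<Sum>j<max N B. dmat T j k * dmat U n j)"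
    unfolding dsym_act_X_power[of U] sum_distrib_left by (intro sum.cong) auto
  also have "\<dots> = (\<Sum>j<B. dmat T j k * dmat U n j)"
    using assms by (intro sum.mono_neutral_right) (auto simp: not_less)
  finally show ?thesis .
qed

lemma dmat_add: "dmat (T + U) n k = dmat T n k + dmat U n k"
  by (simp add: dmat_act dsym_act_add_left ring_distribs)

lemma dmat_0: "dmat 0 n k = 0"
  using dmat_add[of 0 0 n k] by simp

lemma dmat_uminus: "dmat (- T) n k = - dmat T n k"
  by (simp add: dmat_act dsym_act_uminus)

lemma dmat_diff: "dmat (T - U) n k = dmat T n k - dmat U n k"
  using dmat_add[of T "- U"] by (simp add: dmat_uminus)

lemma dmat_bounded: "\<exists>M. \<forall>n k. n > k + M \<longrightarrow> dmat T n k = 0"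
proof -
  obtain M where M: "\<forall>s i. dsym_coeff T s $ i \<noteq> 0 \<longrightarrow> s \<le> i + M" using dsym_bounded by blast
  have "dmat T n k = 0" if "n > k + M" for n k
    unfolding dmat_def
  proof (intro sum.neutral ballI)
    fix i
    have "dsym_coeff T (i + n - k) $ i = 0" using M that by fastforce
    then show "(if k \<le> i + n then dsym_coeff T (i + n - k) $ i * (fact i * of_nat (k choose i)) else 0) = 0"
      by simp
  qed
  then show ?thesis by blast
qed

lemma dmat_hcomp: "dmat (dsym_hcomp T r) n k = (if int n - int k = r then dmat T n k else 0)"
proof (cases "int n - int k = r")
  case True
  show ?thesis unfolding dmat_def using True
    by (auto simp: dsym_hcomp.rep_eq intro!: sum.cong)
next
  case False
  then have "dmat (dsym_hcomp T r) n k = 0"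
    unfolding dmat_def by (intro sum.neutral) (auto simp: dsym_hcomp.rep_eq of_nat_diff)
  then show ?thesis using False by simp
qed

lemma dmat_1: "dmat 1 n k = (if n = k then 1 else 0)"
  by (simp add: dmat_act dsym_act_1 fps_X_power_nth)

lemma dmat_const_mult: "dmat (dsym_const c * T) n k = c * dmat T n k"
  by (simp add: dmat_act dsym_act_mult dsym_const_def dsym_act_fun)

lemma dsym_const_commute: "dsym_const c * T = T * dsym_const c"
  by (rule dmat_eqI) (simp add: dmat_act dsym_act_mult dsym_const_def dsym_act_fun dsym_act_const_mult)

lemma field_embedding_of_nat:
  fixes \<iota> :: "'a::field_char_0 \<Rightarrow> 'b::field_char_0"
  assumes "field_embedding \<iota>" shows "\<iota> 0 = 0" "\<iota> (of_nat n) = of_nat n"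
proof -
  have "\<iota> 0 + \<iota> 0 = \<iota> 0" using assms by (metis field_embedding_def add_0)
  then show 0: "\<iota> 0 = 0" by simp
  show "\<iota> (of_nat n) = of_nat n"
    using assms 0 by (induction n) (auto simp: field_embedding_def)
qed

lemma field_embedding_sum:
  fixes \<iota> :: "'a::field_char_0 \<Rightarrow> 'b::field_char_0"
  assumes "field_embedding \<iota>" shows "\<iota> (\<Sum>i\<in>A. f i) = (\<Sum>i\<in>A. \<iota> (f i))"
  using assms field_embedding_of_nat(1)[OF assms]
  by (induction A rule: infinite_finite_induct) (auto simp: field_embedding_def)

lemma dmat_map:
  assumes "field_embedding \<iota>"
  shows "dmat (dsym_map \<iota> T) n k = \<iota> (dmat T n k)"
proof -
  have m: "\<iota> (x * y) = \<iota> x * \<iota> y" for x y using assms by (simp add: field_embedding_def)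
  have "\<iota> (fact i * of_nat j) = fact i * of_nat j" for i j
    using field_embedding_of_nat(2)[OF assms, of "fact i * j"] by simp
  then show ?thesis
    unfolding dmat_def field_embedding_sum[OF assms]
    by (intro sum.cong) (auto simp: dsym_coeff_map[OF assms] field_embedding_of_nat(1)[OF assms] m)
qed

section \<open>Differences and quasi-polynomial germs\<close>

text \<open>
  The difference operator with step \<open>q\<close>.  It is the shadow of the commutator with \<open>\<partial>^q\<close> on a
  diagonal of the matrix, it kills the \<open>q\<close>-periodic functions, and it lowers the degree in \<open>m\<close> of a
  polynomial in \<open>m\<close> with \<open>q\<close>-periodic coefficients by one.
\<close>

definition fdiff :: "nat \<Rightarrow> (nat \<Rightarrow> 'a::comm_ring_1) \<Rightarrow> nat \<Rightarrow> 'a" where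
  "fdiff q h = (\<lambda>m. h (m + q) - h m)"

lemma fdiff_pow_Suc: "(fdiff q ^^ Suc k) h m = (fdiff q ^^ k) h (m + q) - (fdiff q ^^ k) h m"
  by (simp add: fdiff_def)

lemma fdiff_pow_sum:
  "(fdiff q ^^ k) (\<lambda>m. \<Sum>i\<in>A. f i m) = (\<lambda>m. \<Sum>i\<in>A. (fdiff q ^^ k) (f i) m)"
  by (induction k) (auto simp: fdiff_def sum_subtractf)

lemma fdiff_pow_add:
  "(fdiff q ^^ k) (\<lambda>m. f m + g m) = (\<lambda>m. (fdiff q ^^ k) f m + (fdiff q ^^ k) g m)"
  by (induction k) (auto simp: fdiff_def)

lemma fdiff_pow_diff:
  "(fdiff q ^^ k) (\<lambda>m. f m - g m) = (\<lambda>m. (fdiff q ^^ k) f m - (fdiff q ^^ k) g m)"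
  by (induction k) (auto simp: fdiff_def)

lemma fdiff_pow_periodic_mult:
  assumes "\<And>m. c (m + q) = c m"
  shows "(fdiff q ^^ k) (\<lambda>m. c m * f m) = (\<lambda>m. c m * (fdiff q ^^ k) f m)"
  by (induction k) (auto simp: fdiff_def assms right_diff_distrib)

lemma fdiff_pow_mono:
  assumes "\<And>m. (fdiff q ^^ k) h m = 0" "k \<le> l"
  shows "(fdiff q ^^ l) h m = 0"
  using assms(2) by (induction l arbitrary: m rule: dec_induct) (auto simp: assms(1) fdiff_def)

lemma fdiff_pow_eventually_cong:
  assumes "eventually (\<lambda>m. f m = g m) sequentially"
  shows "eventually (\<lambda>m. (fdiff q ^^ k) f m = (fdiff q ^^ k) g m) sequentially"
proof (induction k)
  case (Suc k)
  then have "eventually (\<lambda>m. (fdiff q ^^ k) f (m + q) = (fdiff q ^^ k) g (m + q)) sequentially"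
    by (rule sequentially_offset)
  with Suc show ?case by eventually_elim (simp add: fdiff_pow_Suc del: funpow.simps)
qed (use assms in simp)

text \<open>
  The Leibniz rule for differences: \<open>\<Delta>(f g)(m) = \<Delta>f(m) g(m + q) + f(m) \<Delta>g(m)\<close>, iterated.
\<close>

lemma fdiff_pow_mult:
  "(fdiff q ^^ n) (\<lambda>m. f m * g m) m
    = (\<Sum>i\<le>n. of_nat (n choose i) * (fdiff q ^^ i) f m * (fdiff q ^^ (n - i)) g (m + i * q))"
proof (induction n arbitrary: m)
  case (Suc n)
  define t where "t i j m = (fdiff q ^^ i) f m * (fdiff q ^^ j) g (m + i * q)" for i j m
  have step: "t i j (m + q) - t i j m = t (Suc i) j m + t i (Suc j) m" for i j
    by (simp add: t_def fdiff_def algebra_simps)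
  have "(fdiff q ^^ Suc n) (\<lambda>m. f m * g m) m
      = (\<Sum>i\<le>n. of_nat (n choose i) * (t i (n - i) (m + q) - t i (n - i) m))"
    unfolding fdiff_pow_Suc Suc t_def by (simp add: sum_subtractf algebra_simps)
  also have "\<dots> = (\<Sum>i\<le>n. of_nat (n choose i) * t (Suc i) (n - i) m)
      + (\<Sum>i\<le>n. of_nat (n choose i) * t i (Suc n - i) m)"
    unfolding step by (simp add: sum.distrib ring_distribs Suc_diff_le)
  also have "(\<Sum>i\<le>n. of_nat (n choose i) * t i (Suc n - i) m)
      = (\<Sum>i\<le>Suc n. of_nat (n choose i) * t i (Suc n - i) m)" by (simp add: binomial_eq_0)
  also have "(\<Sum>i\<le>n. of_nat (n choose i) * t (Suc i) (n - i) m) + \<dots>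
      = (\<Sum>i\<le>Suc n. of_nat (Suc n choose i) * t i (Suc n - i) m)"
    unfolding sum.atMost_Suc_shift by (simp add: sum.distrib ring_distribs)
  finally show ?case by (simp add: t_def mult.assoc)
qed simp

text \<open>
  For large \<open>m\<close> the function \<open>h\<close> is a polynomial in \<open>m\<close> with \<open>q\<close>-periodic coefficients, of degree
  at most \<open>\<delta>\<close>, and its coefficient of \<open>m^\<delta>\<close> is the constant \<open>c / q^\<delta>\<close>.  Stating this through
  differences avoids the polynomials themselves.  A degree bound \<open>\<delta>\<close> that is not a natural number
  cannot be attained; forcing \<open>c = 0\<close> then makes \<open>c\<close> multiplicative in all cases.
  Only the germ at infinity matters: products of operators produce shifts of \<open>m\<close> by negative
  integers, which make sense for large \<open>m\<close> only.
\<close>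

definition qpoly :: "nat \<Rightarrow> real \<Rightarrow> 'a::field_char_0 \<Rightarrow> (nat \<Rightarrow> 'a) \<Rightarrow> bool" where
  "qpoly q \<delta> c h \<longleftrightarrow> (\<delta> \<notin> \<nat> \<longrightarrow> c = 0) \<and>
     (\<forall>k. \<delta> \<le> real k \<longrightarrow> (\<forall>\<^sub>F m in sequentially.
        (fdiff q ^^ k) h m = (if real k = \<delta> then fact k * c else 0)))"

lemma qpoly_add:
  assumes "qpoly q \<delta> c f" "qpoly q \<delta> d g"
  shows "qpoly q \<delta> (c + d) (\<lambda>m. f m + g m)"
  unfolding qpoly_def
proof (intro conjI impI allI)
  show "c + d = 0" if "\<delta> \<notin> \<nat>" using assms that by (simp add: qpoly_def)
next
  fix k assume "\<delta> \<le> real k"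
  then have "\<forall>\<^sub>F m in sequentially. (fdiff q ^^ k) f m = (if real k = \<delta> then fact k * c else 0)"
    "\<forall>\<^sub>F m in sequentially. (fdiff q ^^ k) g m = (if real k = \<delta> then fact k * d else 0)"
    using assms by (auto simp: qpoly_def)
  then show "\<forall>\<^sub>F m in sequentially. (fdiff q ^^ k) (\<lambda>m. f m + g m) m
      = (if real k = \<delta> then fact k * (c + d) else 0)"
    by eventually_elim (auto simp: fdiff_pow_add algebra_simps)
qed

lemma fdiff_pow_0: "(fdiff q ^^ k) (\<lambda>m. 0) = (\<lambda>m. 0)"
  by (induction k) (auto simp: fdiff_def)

lemma qpoly_0: "qpoly q \<delta> 0 (\<lambda>m. 0)"
  by (simp add: qpoly_def fdiff_pow_0)

lemma qpoly_sum:
  assumes "\<And>i. i \<in> A \<Longrightarrow> qpoly q \<delta> (c i) (f i)"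
  shows "qpoly q \<delta> (\<Sum>i\<in>A. c i) (\<lambda>m. \<Sum>i\<in>A. f i m)"
  using assms by (induction A rule: infinite_finite_induct) (auto intro: qpoly_0 qpoly_add)

lemma qpoly_cong:
  assumes "qpoly q \<delta> c f" "eventually (\<lambda>m. f m = g m) sequentially"
  shows "qpoly q \<delta> c g"
  unfolding qpoly_def
proof (intro conjI impI allI)
  show "c = 0" if "\<delta> \<notin> \<nat>" using assms that by (simp add: qpoly_def)
next
  fix k assume "\<delta> \<le> real k"
  then have "\<forall>\<^sub>F m in sequentially. (fdiff q ^^ k) f m = (if real k = \<delta> then fact k * c else 0)"
    using assms by (auto simp: qpoly_def)
  with fdiff_pow_eventually_cong[OF assms(2), where q = q and k = k]
  show "\<forall>\<^sub>F m in sequentially. (fdiff q ^^ k) g m = (if real k = \<delta> then fact k * c else 0)"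
    by eventually_elim simp
qed

lemma qpoly_less:
  assumes "qpoly q \<delta> c f" "\<delta> < \<epsilon>"
  shows "qpoly q \<epsilon> 0 f"
  unfolding qpoly_def
proof (intro conjI impI allI)
  fix k assume "\<epsilon> \<le> real k"
  then have "\<delta> \<le> real k" using assms(2) by linarith
  then have "\<forall>\<^sub>F m in sequentially. (fdiff q ^^ k) f m = (if real k = \<delta> then fact k * c else 0)"
    using assms by (auto simp: qpoly_def)
  then show "\<forall>\<^sub>F m in sequentially. (fdiff q ^^ k) f m = (if real k = \<epsilon> then fact k * 0 else 0)"
    by eventually_elim (use assms(2) \<open>\<epsilon> \<le> real k\<close> in auto)
qed simp

lemma qpoly_0_unique:
  assumes "qpoly q \<delta> c (\<lambda>m. 0)"
  shows "c = 0"
proof (cases "\<delta> \<in> \<nat>")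
  case True
  then obtain k where "\<delta> = real k" by (auto elim: Nats_cases)
  then have "\<forall>\<^sub>F m in sequentially. (0 :: 'a) = fact k * c"
    using assms by (auto simp: qpoly_def fdiff_pow_0)
  then show ?thesis by simp
qed (use assms in \<open>auto simp: qpoly_def\<close>)

lemma fdiff_pow_int_shift:
  assumes "int m + r \<ge> 0"
  shows "(fdiff q ^^ k) (\<lambda>m. h (nat (int m + r))) m = (fdiff q ^^ k) h (nat (int m + r))"
  using assms
proof (induction k arbitrary: m)
  case (Suc k)
  have "nat (int (m + q) + r) = nat (int m + r) + q" using Suc.prems by auto
  then show ?case using Suc.IH[of m] Suc.IH[of "m + q"] Suc.prems by (simp add: fdiff_def)
qed simp

lemma eventually_int_shift:
  assumes "eventually P sequentially"
  shows "eventually (\<lambda>m. int m + r \<ge> 0 \<and> P (nat (int m + r))) sequentially"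
proof -
  obtain N where N: "\<And>m. m \<ge> N \<Longrightarrow> P m" using assms by (auto simp: eventually_sequentially)
  show ?thesis unfolding eventually_sequentially
    by (rule exI[of _ "N + nat \<bar>r\<bar>"]) (auto intro!: N)
qed

lemma qpoly_int_shift:
  assumes "qpoly q \<delta> c h"
  shows "qpoly q \<delta> c (\<lambda>m. h (nat (int m + r)))"
  unfolding qpoly_def
proof (intro conjI impI allI)
  show "c = 0" if "\<delta> \<notin> \<nat>" using assms that by (simp add: qpoly_def)
next
  fix k assume "\<delta> \<le> real k"
  then have "\<forall>\<^sub>F m in sequentially. (fdiff q ^^ k) h m = (if real k = \<delta> then fact k * c else 0)"
    using assms by (auto simp: qpoly_def)
  from eventually_int_shift[OF this, of r]
  show "\<forall>\<^sub>F m in sequentially. (fdiff q ^^ k) (\<lambda>m. h (nat (int m + r))) m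
      = (if real k = \<delta> then fact k * c else 0)"
    by eventually_elim (simp add: fdiff_pow_int_shift)
qed

text \<open>
  In the Leibniz sum of length \<open>n \<ge> \<delta> + \<epsilon>\<close> every term has a factor differenced more often than
  its degree allows, except the one with \<open>i = \<delta>\<close> and \<open>n - i = \<epsilon>\<close>, and there the binomial
  coefficient turns \<open>\<delta>! \<epsilon>!\<close> into \<open>n!\<close>.
\<close>

lemma qpoly_mult:
  fixes f g :: "nat \<Rightarrow> 'a::field_char_0"
  assumes f: "qpoly q \<delta> c f" and g: "qpoly q \<epsilon> d g"
  shows "qpoly q (\<delta> + \<epsilon>) (c * d) (\<lambda>m. f m * g m)"
  unfolding qpoly_def
proof (intro conjI impI allI)
  show "c * d = 0" if "\<delta> + \<epsilon> \<notin> \<nat>"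
  proof (rule ccontr)
    assume "c * d \<noteq> 0"
    then have "\<delta> \<in> \<nat>" "\<epsilon> \<in> \<nat>" using f g by (auto simp: qpoly_def)
    then show False using that by simp
  qed
next
  fix n assume n: "\<delta> + \<epsilon> \<le> real n"
  define t where "t i = (if real i = \<delta> \<and> real (n - i) = \<epsilon> then fact n * (c * d) else 0)" for i
  have "\<forall>\<^sub>F m in sequentially. of_nat (n choose i) * (fdiff q ^^ i) f m
      * (fdiff q ^^ (n - i)) g (m + i * q) = t i" if i: "i \<le> n" for i
  proof -
    have F: "\<forall>\<^sub>F m in sequentially. (fdiff q ^^ i) f m = (if real i = \<delta> then fact i * c else 0)"
      if "\<delta> \<le> real i" using f that by (auto simp: qpoly_def)
    have G: "\<forall>\<^sub>F m in sequentially. (fdiff q ^^ (n - i)) g (m + i * q)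
        = (if real (n - i) = \<epsilon> then fact (n - i) * d else 0)"
      if "\<epsilon> \<le> real (n - i)"
    proof (rule sequentially_offset)
      show "\<forall>\<^sub>F m in sequentially. (fdiff q ^^ (n - i)) g m
        = (if real (n - i) = \<epsilon> then fact (n - i) * d else 0)" using g that by (auto simp: qpoly_def)
    qed
    have ni: "real (n - i) = real n - real i" using i by (simp add: of_nat_diff)
    consider "\<delta> < real i" | "\<epsilon> < real (n - i)" | "\<delta> = real i" "\<epsilon> = real (n - i)"
      using n ni by linarith
    then show ?thesis
    proof cases
      case 1
      then have "\<forall>\<^sub>F m in sequentially. (fdiff q ^^ i) f m = 0" using F by simp
      then show ?thesis by eventually_elim (use 1 in \<open>simp add: t_def\<close>)
    next
      case 2
      then have "\<forall>\<^sub>F m in sequentially. (fdiff q ^^ (n - i)) g (m + i * q) = 0" using G by simp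
      then show ?thesis by eventually_elim (use 2 in \<open>simp add: t_def\<close>)
    next
      case 3
      have "(of_nat (n choose i) :: 'a) * fact i * fact (n - i) = fact n"
        using i by (simp add: binomial_fact)
      then have *: "of_nat (n choose i) * (fact i * c) * (fact (n - i) * d) = fact n * (c * d)"
        by (metis mult.assoc mult.left_commute)
      have "\<forall>\<^sub>F m in sequentially. (fdiff q ^^ i) f m = fact i * c"
        "\<forall>\<^sub>F m in sequentially. (fdiff q ^^ (n - i)) g (m + i * q) = fact (n - i) * d"
        using F G 3 by simp_all
      then show ?thesis by eventually_elim (use 3 * in \<open>simp add: t_def\<close>)
    qed
  qed
  then have "\<forall>\<^sub>F m in sequentially. \<forall>i\<in>{..n}. of_nat (n choose i) * (fdiff q ^^ i) f m
      * (fdiff q ^^ (n - i)) g (m + i * q) = t i"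
    by (intro eventually_ball_finite) auto
  then have "\<forall>\<^sub>F m in sequentially. (fdiff q ^^ n) (\<lambda>m. f m * g m) m = (\<Sum>i\<le>n. t i)"
    by eventually_elim (unfold fdiff_pow_mult, intro sum.cong, auto)
  moreover have "(\<Sum>i\<le>n. t i) = (if real n = \<delta> + \<epsilon> then fact n * (c * d) else 0)"
  proof (cases "real n = \<delta> + \<epsilon> \<and> \<delta> \<in> \<nat> \<and> \<epsilon> \<in> \<nat>")
    case True
    then obtain i j where ij: "\<delta> = real i" "\<epsilon> = real j" by (auto elim!: Nats_cases)
    then have nij: "n = i + j" using True by linarith
    have "(\<Sum>l\<le>n. t l) = (\<Sum>l\<le>n. if l = i then fact n * (c * d) else 0)"
      by (intro sum.cong) (auto simp: t_def ij nij)
    then show ?thesis using True nij by simp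
  next
    case False
    have "t i = 0" if "i \<le> n" for i
      using False that by (auto simp: t_def of_nat_diff)
    moreover have "c * d = 0" if "real n = \<delta> + \<epsilon>"
      using False that f g by (auto simp: qpoly_def)
    ultimately show ?thesis by simp
  qed
  ultimately show "\<forall>\<^sub>F m in sequentially. (fdiff q ^^ n) (\<lambda>m. f m * g m) m
      = (if real n = \<delta> + \<epsilon> then fact n * (c * d) else 0)" by simp
qed

section \<open>Exponential polynomials\<close>

lemma sum_powers_root_of_unity:
  fixes \<omega> :: "'b::field_char_0"
  assumes "\<omega> ^ q = 1"
  shows "(\<Sum>i<q. \<omega> ^ i) = (if \<omega> = 1 then of_nat q else 0)"
  using assms by (simp add: geometric_sum)

context
  fixes q :: nat and \<xi> :: "'b::field_char_0"
  assumes prim: "primitive_root_of_unity q \<xi>"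
begin

lemma prim_root: "q > 0" "\<xi> ^ q = 1" "\<xi> \<noteq> 0" "\<xi> ^ (q - 1) = inverse \<xi>"
proof -
  show q: "q > 0" and 1: "\<xi> ^ q = 1" using prim by (auto simp: primitive_root_of_unity_def)
  show 0: "\<xi> \<noteq> 0" using q 1 by (auto simp: power_0_left)
  have "\<xi> ^ (q - 1) * \<xi> = 1" using q 1 by (simp flip: power_Suc2)
  then show "\<xi> ^ (q - 1) = inverse \<xi>" using 0 by (simp add: field_simps)
qed

lemma prim_root_inj:
  assumes "i < q" "j < q" "\<xi> ^ i = \<xi> ^ j" shows "i = j"
proof -
  have *: "i = j" if "i \<le> j" "i < q" "j < q" "\<xi> ^ i = \<xi> ^ j" for i j
  proof (rule ccontr)
    assume "i \<noteq> j"
    then have "0 < j - i" "j - i < q" using that by auto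
    then have "\<xi> ^ (j - i) \<noteq> 1" using prim by (auto simp: primitive_root_of_unity_def)
    moreover have "\<xi> ^ (j - i) * \<xi> ^ i = \<xi> ^ i" using that by (metis le_add_diff_inverse2 power_add)
    ultimately show False using prim_root(3) by simp
  qed
  show ?thesis using assms *[of i j] *[of j i] by (cases "i \<le> j") auto
qed

lemma prim_root_orthogonality:
  assumes "i < q" "j < q"
  shows "(\<Sum>m<q. \<xi> ^ (i * m) * inverse \<xi> ^ (j * m)) = (if i = j then of_nat q else 0)"
proof -
  let ?w = "\<xi> ^ i * inverse \<xi> ^ j"
  have "?w ^ q = 1"
    using prim_root(2) by (simp add: power_mult_distrib power_inverse mult.commute[of _ q] flip: power_mult)
      (simp add: power_mult)
  moreover have "?w = 1 \<longleftrightarrow> i = j"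
    using prim_root(3) prim_root_inj[OF assms] by (auto simp: power_inverse field_simps)
  ultimately show ?thesis
    using sum_powers_root_of_unity[of ?w q] by (simp add: power_mult_distrib power_mult)
qed

lemma periodic_mod:
  assumes "\<And>m. c (m + q) = c m" shows "c m = c (m mod q)"
proof -
  have "c (m mod q + n * q) = c (m mod q)" for n
  proof (induction n)
    case (Suc n)
    have "c (m mod q + Suc n * q) = c ((m mod q + n * q) + q)" by (simp add: ac_simps)
    then show ?case using assms Suc by simp
  qed simp
  from this[of "m div q"] show ?thesis by simp
qed

lemma prim_root_periodic: "\<xi> ^ (i * (m + q)) = \<xi> ^ (i * m)"
  using prim_root(2) by (simp add: ring_distribs power_add mult.commute[of i q] power_mult)

text \<open>
  Periodic functions are combinations of the characters \<open>m \<mapsto> \<xi>^(i m)\<close>.  The inverse of \<open>\<xi>\<close> is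
  written as a power of \<open>\<xi>\<close>, which shows that the coefficients lie in every ring that contains \<open>\<xi>\<close>,
  \<open>1 / q\<close> and the values of \<open>c\<close>.
\<close>

lemma fourier_expansion:
  assumes c: "\<And>m. c (m + q) = c m"
  shows "c m = (\<Sum>i<q. (\<Sum>a<q. c a * (\<xi> ^ (q - 1)) ^ (i * a)) / of_nat q * \<xi> ^ (i * m))"
proof -
  let ?n = "m mod q"
  have n: "?n < q" using prim_root(1) by simp
  have "(\<Sum>i<q. (\<Sum>a<q. c a * (\<xi> ^ (q - 1)) ^ (i * a)) / of_nat q * \<xi> ^ (i * m))
      = (\<Sum>i<q. (\<Sum>a<q. c a * inverse \<xi> ^ (i * a)) / of_nat q * \<xi> ^ (i * ?n))"
    by (intro sum.cong refl arg_cong2[where f = "(*)"] periodic_mod[of "\<lambda>m. \<xi> ^ (_ * m)"])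
      (simp_all add: prim_root(4)[simplified] prim_root_periodic)
  also have "\<dots> = (\<Sum>i<q. \<Sum>a<q. c a / of_nat q * (\<xi> ^ (?n * i) * inverse \<xi> ^ (a * i)))"
    by (simp add: sum_distrib_left sum_distrib_right sum_divide_distrib ac_simps)
  also have "\<dots> = (\<Sum>a<q. c a / of_nat q * (\<Sum>i<q. \<xi> ^ (?n * i) * inverse \<xi> ^ (a * i)))"
    unfolding sum_distrib_left by (rule sum.swap)
  also have "\<dots> = (\<Sum>a<q. if a = ?n then c a else 0)"
    using prim_root(1) n by (intro sum.cong) (auto simp: prim_root_orthogonality)
  also have "\<dots> = c m" using n periodic_mod[of c, OF c, of m] by simp
  finally show ?thesis by simp
qed

lemma fourier_unique:
  assumes "\<And>m. (\<Sum>i<q. f i * \<xi> ^ (i * m)) = 0" "j < q"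
  shows "f j = 0"
proof -
  have "0 = (\<Sum>m<q. (\<Sum>i<q. f i * \<xi> ^ (i * m)) * inverse \<xi> ^ (j * m))" using assms by simp
  also have "\<dots> = (\<Sum>m<q. \<Sum>i<q. f i * (\<xi> ^ (i * m) * inverse \<xi> ^ (j * m)))"
    by (simp add: sum_distrib_right mult.assoc)
  also have "\<dots> = (\<Sum>i<q. f i * (\<Sum>m<q. \<xi> ^ (i * m) * inverse \<xi> ^ (j * m)))"
    unfolding sum_distrib_left by (rule sum.swap)
  also have "\<dots> = (\<Sum>i<q. if i = j then f i * of_nat q else 0)"
    using assms(2) by (intro sum.cong) (auto simp: prim_root_orthogonality)
  also have "\<dots> = f j * of_nat q" using assms(2) by simp
  finally show ?thesis using prim_root(1) by simp
qed

end

lemma fdiff_pow_times_of_nat: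
  "(fdiff q ^^ Suc n) (\<lambda>m. of_nat m * g m) m
    = of_nat m * (fdiff q ^^ Suc n) g m + of_nat (Suc n * q) * (fdiff q ^^ n) g (m + q)"
proof (induction n arbitrary: m)
  case (Suc n)
  show ?case
    unfolding fdiff_pow_Suc[of "Suc n"] Suc.IH
    by (simp add: fdiff_pow_Suc algebra_simps del: funpow.simps)
qed (simp add: fdiff_def algebra_simps)

lemma fdiff_pow_power:
  assumes "l \<le> k"
  shows "(fdiff q ^^ k) (\<lambda>m. of_nat m ^ l) m = (if k = l then fact l * of_nat q ^ l else 0 :: 'a::field_char_0)"
  using assms
proof (induction l arbitrary: k m)
  case 0
  have "(fdiff q ^^ Suc k) (\<lambda>m. 1 :: 'a) m = 0" for k m
    by (rule fdiff_pow_mono[of 1]) (auto simp: fdiff_def)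
  then show ?case by (cases k) auto
next
  case (Suc l)
  then obtain n where n: "k = Suc n" by (cases k) auto
  show ?case
    unfolding n power_Suc fdiff_pow_times_of_nat using Suc n by (simp del: funpow.simps add: algebra_simps)
qed

lemma map_poly_embedding:
  fixes \<iota> :: "'a::field_char_0 \<Rightarrow> 'b::field_char_0"
  assumes "field_embedding \<iota>"
  shows "map_poly \<iota> (u + v) = map_poly \<iota> u + map_poly \<iota> v"
    "map_poly \<iota> (u * v) = map_poly \<iota> u * map_poly \<iota> v"
  using assms field_embedding_of_nat(1)[OF assms]
  by (auto intro!: poly_eqI simp: coeff_map_poly coeff_mult field_embedding_sum field_embedding_def)

context
  fixes \<iota> :: "'a::field_char_0 \<Rightarrow> 'b::field_char_0" and \<xi> :: 'b
  assumes emb: "field_embedding \<iota>"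
begin

lemma adjoin_add: "u \<in> adjoin \<iota> \<xi> \<Longrightarrow> v \<in> adjoin \<iota> \<xi> \<Longrightarrow> u + v \<in> adjoin \<iota> \<xi>"
  unfolding adjoin_def by (clarsimp, metis map_poly_embedding(1)[OF emb] poly_add)

lemma adjoin_mult: "u \<in> adjoin \<iota> \<xi> \<Longrightarrow> v \<in> adjoin \<iota> \<xi> \<Longrightarrow> u * v \<in> adjoin \<iota> \<xi>"
  unfolding adjoin_def by (clarsimp, metis map_poly_embedding(2)[OF emb] poly_mult)

lemma adjoin_base: "\<iota> c \<in> adjoin \<iota> \<xi>"
  unfolding adjoin_def
  by (rule CollectI, rule exI[of _ "[:c:]"]) (simp add: map_poly_pCons field_embedding_of_nat[OF emb])

lemma adjoin_generator: "\<xi> \<in> adjoin \<iota> \<xi>"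
proof -
  have "\<iota> 1 = 1" using emb by (simp add: field_embedding_def)
  then show ?thesis unfolding adjoin_def
    by (intro CollectI exI[of _ "[:0, 1:]"]) (simp add: map_poly_pCons field_embedding_of_nat[OF emb])
qed

lemma adjoin_0: "0 \<in> adjoin \<iota> \<xi>" and adjoin_1: "1 \<in> adjoin \<iota> \<xi>"
  using adjoin_base[of 0] adjoin_base[of 1] emb field_embedding_of_nat(1)[OF emb]
  by (simp_all add: field_embedding_def)

lemma adjoin_of_nat: "of_nat n \<in> adjoin \<iota> \<xi>"
  using adjoin_base[of "of_nat n"] field_embedding_of_nat(2)[OF emb] by simp

lemma adjoin_inverse_of_nat: "inverse (of_nat n) \<in> adjoin \<iota> \<xi>"
proof (cases "n = 0")
  case False
  have "\<iota> (of_nat n * inverse (of_nat n)) = \<iota> (of_nat n) * \<iota> (inverse (of_nat n))"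
    using emb unfolding field_embedding_def by blast
  then have "of_nat n * \<iota> (inverse (of_nat n)) = 1"
    using False emb field_embedding_of_nat(2)[OF emb] by (simp add: field_embedding_def)
  then have "\<iota> (inverse (of_nat n)) = inverse (of_nat n)"
    by (metis inverse_unique)
  then show ?thesis using adjoin_base[of "inverse (of_nat n)"] by simp
qed (simp add: adjoin_0)

lemma adjoin_power: "u \<in> adjoin \<iota> \<xi> \<Longrightarrow> u ^ n \<in> adjoin \<iota> \<xi>"
  by (induction n) (auto intro: adjoin_1 adjoin_mult)

lemma adjoin_sum: "(\<And>i. i \<in> I \<Longrightarrow> u i \<in> adjoin \<iota> \<xi>) \<Longrightarrow> (\<Sum>i\<in>I. u i) \<in> adjoin \<iota> \<xi>"
  by (induction I rule: infinite_finite_induct) (auto intro: adjoin_0 adjoin_add)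

lemma adjoin_diff: "u \<in> adjoin \<iota> \<xi> \<Longrightarrow> v \<in> adjoin \<iota> \<xi> \<Longrightarrow> u - v \<in> adjoin \<iota> \<xi>"
proof -
  assume uv: "u \<in> adjoin \<iota> \<xi>" "v \<in> adjoin \<iota> \<xi>"
  have "\<iota> (- 1) + \<iota> 1 = \<iota> 0" using emb unfolding field_embedding_def by (metis add.left_inverse)
  then have "\<iota> (- 1) = - 1"
    using emb field_embedding_of_nat(1)[OF emb] by (simp add: field_embedding_def eq_neg_iff_add_eq_0)
  then have "- 1 \<in> adjoin \<iota> \<xi>" using adjoin_base[of "- 1"] by simp
  from adjoin_add[OF uv(1) adjoin_mult[OF this uv(2)]] show ?thesis by simp
qed

lemma adjoin_fdiff:
  assumes "\<And>m. h m \<in> adjoin \<iota> \<xi>"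
  shows "(fdiff q ^^ k) h m \<in> adjoin \<iota> \<xi>"
  by (induction k arbitrary: m) (auto simp: fdiff_def assms intro: adjoin_diff)

text \<open>
  Induction on \<open>L\<close>: if \<open>\<Delta>^(L+1) h = 0\<close>, then \<open>\<Delta>^L h\<close> is periodic, and subtracting from \<open>h\<close> the
  term \<open>\<Delta>^L h * m^L / (L! q^L)\<close> leaves a function killed by \<open>\<Delta>^L\<close>.  The periodic coefficient is
  expanded into characters, and nothing in this process leaves the ring \<open>K[\<xi>]\<close>.
\<close>

lemma exponential_polynomial_of_fdiff:
  assumes prim: "primitive_root_of_unity q \<xi>"
    and "\<And>m. (fdiff q ^^ L) h m = 0" "\<And>m. h m \<in> adjoin \<iota> \<xi>"
  shows "\<exists>f. (\<forall>l i. f l i \<in> adjoin \<iota> \<xi>) \<and>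
    (\<forall>m. h m = (\<Sum>l<L. \<Sum>i<q. f l i * \<xi> ^ (i * m) * of_nat m ^ l))"
  using assms(2,3)
proof (induction L arbitrary: h)
  case 0
  then show ?case by (intro exI[of _ "\<lambda>_ _. 0"]) (auto intro: adjoin_0)
next
  case (Suc L)
  define C :: 'b where "C = inverse (of_nat (fact L * q ^ L))"
  define c where "c m = C * (fdiff q ^^ L) h m" for m
  have q: "q > 0" using prim_root[OF prim] by simp
  have cA: "c m \<in> adjoin \<iota> \<xi>" for m
    unfolding c_def C_def using Suc.prems(2) by (intro adjoin_mult adjoin_inverse_of_nat adjoin_fdiff)
  have per: "c (m + q) = c m" for m
    using Suc.prems(1)[of m] by (simp add: c_def fdiff_pow_Suc del: funpow.simps)
  define g where "g m = h m - c m * of_nat m ^ L" for m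
  have gA: "g m \<in> adjoin \<iota> \<xi>" for m
    unfolding g_def using Suc.prems(2) cA by (intro adjoin_diff adjoin_mult adjoin_power adjoin_of_nat)
  have "(fdiff q ^^ L) g m = (fdiff q ^^ L) h m - c m * (fact L * of_nat q ^ L)" for m
    unfolding g_def fdiff_pow_diff
    using fun_cong[OF fdiff_pow_periodic_mult[of c q L "\<lambda>m. of_nat m ^ L", OF per], of m]
    by (simp add: fdiff_pow_power)
  moreover have "c m * (fact L * of_nat q ^ L) = (fdiff q ^^ L) h m" for m
    using q by (simp add: c_def C_def field_simps)
  ultimately have "(fdiff q ^^ L) g m = 0" for m by simp
  from Suc.IH[OF this gA] obtain f where f: "\<And>l i. f l i \<in> adjoin \<iota> \<xi>"
    "\<And>m. g m = (\<Sum>l<L. \<Sum>i<q. f l i * \<xi> ^ (i * m) * of_nat m ^ l)" by blast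
  define u where "u i = (\<Sum>a<q. c a * (\<xi> ^ (q - 1)) ^ (i * a)) * inverse (of_nat q)" for i
  have uA: "u i \<in> adjoin \<iota> \<xi>" for i
    unfolding u_def by (intro adjoin_mult adjoin_sum cA adjoin_power adjoin_generator adjoin_inverse_of_nat)
  have "h m = g m + (\<Sum>i<q. u i * \<xi> ^ (i * m)) * of_nat m ^ L" for m
    using fourier_expansion[OF prim, of c m, OF per] by (simp add: g_def u_def divide_inverse)
  then have "h m = (\<Sum>l<Suc L. \<Sum>i<q. (if l = L then u i else f l i) * \<xi> ^ (i * m) * of_nat m ^ l)" for m
    by (simp add: f(2) sum_distrib_right)
  then show ?case using f(1) uA by (intro exI[of _ "\<lambda>l i. if l = L then u i else f l i"]) auto
qed

end

lemma fdiff_pow_exponential_polynomial: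
  fixes \<xi> :: "'b::field_char_0"
  assumes "primitive_root_of_unity q \<xi>"
  shows "(fdiff q ^^ k) (\<lambda>m. \<Sum>l\<in>A. \<Sum>i<q. f l i * \<xi> ^ (i * m) * of_nat m ^ l) m
    = (\<Sum>l\<in>A. \<Sum>i<q. f l i * \<xi> ^ (i * m) * (fdiff q ^^ k) (\<lambda>m. of_nat m ^ l) m)"
  unfolding fdiff_pow_sum
  using fun_cong[OF fdiff_pow_periodic_mult[of "\<lambda>m. f _ _ * \<xi> ^ (_ * m)" q k]]
  by (intro sum.cong refl) (simp add: prim_root_periodic[OF assms])

text \<open>
  The converse.  Differencing \<open>n\<close> times, with \<open>n\<close> the largest exponent that occurs, leaves
  \<open>n! q^n\<close> times the periodic coefficient of \<open>m^n\<close>; a periodic function that vanishes for large \<open>m\<close>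
  vanishes everywhere, and the characters are linearly independent.
\<close>

lemma exponential_polynomial_degree:
  fixes \<xi> :: "'b::field_char_0"
  assumes prim: "primitive_root_of_unity q \<xi>"
    and h: "\<forall>\<^sub>F m in sequentially. h m = (\<Sum>l\<le>D. \<Sum>i<q. f l i * \<xi> ^ (i * m) * of_nat m ^ l)"
    and vanish: "\<And>k. k \<ge> L \<Longrightarrow> \<forall>\<^sub>F m in sequentially. (fdiff q ^^ k) h m = 0"
    and li: "L \<le> l" "l \<le> D" "i < q"
  shows "f l i = 0"
proof (rule ccontr)
  assume "f l i \<noteq> 0"
  define X where "X = {l. L \<le> l \<and> l \<le> D \<and> (\<exists>i<q. f l i \<noteq> 0)}"
  have X: "finite X" "X \<noteq> {}" using li \<open>f l i \<noteq> 0\<close> by (auto simp: X_def)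
  define n where "n = Max X"
  have "n \<in> X" using X by (simp add: n_def)
  then have n: "L \<le> n" "n \<le> D" "\<exists>i<q. f n i \<noteq> 0" by (auto simp: X_def)
  have above: "f l i = 0" if "n < l" "l \<le> D" "i < q" for l i
  proof (rule ccontr)
    assume "f l i \<noteq> 0"
    then have "l \<in> X" using that n by (auto simp: X_def)
    from Max_ge[OF X(1) this] that(1) show False unfolding n_def by linarith
  qed
  have top: "(fdiff q ^^ n) (\<lambda>m. \<Sum>l\<le>D. \<Sum>i<q. f l i * \<xi> ^ (i * m) * of_nat m ^ l) m
      = (\<Sum>i<q. f n i * \<xi> ^ (i * m)) * (fact n * of_nat q ^ n)" for m
  proof -
    have "(fdiff q ^^ n) (\<lambda>m. \<Sum>l\<le>D. \<Sum>i<q. f l i * \<xi> ^ (i * m) * of_nat m ^ l) m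
      = (\<Sum>l\<le>D. if l = n then (\<Sum>i<q. f n i * \<xi> ^ (i * m)) * (fact n * of_nat q ^ n) else 0)"
      unfolding fdiff_pow_exponential_polynomial[OF prim]
    proof (intro sum.cong refl)
      fix l assume "l \<in> {..D}"
      consider "l < n" | "l = n" | "n < l" by linarith
      then show "(\<Sum>i<q. f l i * \<xi> ^ (i * m) * (fdiff q ^^ n) (\<lambda>m. of_nat m ^ l) m)
          = (if l = n then (\<Sum>i<q. f n i * \<xi> ^ (i * m)) * (fact n * of_nat q ^ n) else 0)"
        by cases (use above \<open>l \<in> _\<close> in \<open>auto simp: fdiff_pow_power sum_distrib_right\<close>)
    qed
    then show ?thesis using n by simp
  qed
  from fdiff_pow_eventually_cong[OF h, where q = q and k = n] vanish[OF n(1)]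
  have "\<forall>\<^sub>F m in sequentially. (\<Sum>i<q. f n i * \<xi> ^ (i * m)) * (fact n * of_nat q ^ n) = 0"
    by eventually_elim (simp only: top)
  then obtain N where N: "\<And>m. m \<ge> N \<Longrightarrow> (\<Sum>i<q. f n i * \<xi> ^ (i * m)) = 0"
    using prim_root(1)[OF prim] by (auto simp: eventually_sequentially)
  have "(\<Sum>i<q. f n i * \<xi> ^ (i * m)) = 0" for m
  proof -
    have "(\<Sum>i<q. f n i * \<xi> ^ (i * m)) = (\<Sum>i<q. f n i * \<xi> ^ (i * (m + N * q)))"
    proof (intro sum.cong refl arg_cong2[where f = "(*)"])
      fix i
      have "\<xi> ^ (i * (N * q)) = 1"
        using prim_root(2)[OF prim] by (simp add: mult.commute[of _ q] mult.left_commute[of _ q] power_mult)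
      then show "\<xi> ^ (i * m) = \<xi> ^ (i * (m + N * q))" by (simp add: ring_distribs power_add)
    qed
    also have "\<dots> = 0"
    proof (rule N)
      have "N * 1 \<le> N * q" using prim_root(1)[OF prim] by (intro mult_le_mono2) simp
      then show "N \<le> m + N * q" by linarith
    qed
    finally show ?thesis .
  qed
  from fourier_unique[OF prim this] n(3) show False by blast
qed

section \<open>Homogeneous operators and HCPs\<close>

text \<open>
  \<open>T\<close> is homogeneous of order \<open>r\<close>, with \<open>u k\<close> in row \<open>k\<close>.  The value \<open>u k\<close> is irrelevant when
  \<open>k + r < 0\<close>, since row \<open>k\<close> then has no entry on that diagonal.
\<close>

definition homog :: "int \<Rightarrow> (nat \<Rightarrow> 'a::field_char_0) \<Rightarrow> 'a dsym \<Rightarrow> bool" where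
  "homog r u T \<longleftrightarrow> (\<forall>n k. dmat T n k = (if int n - int k = r then u k else 0))"

lemma homogD: "homog r u T \<Longrightarrow> dmat T n k = (if int n - int k = r then u k else 0)"
  by (simp add: homog_def)

lemma homog_mult:
  assumes T: "homog r u T" and U: "homog s v U"
  shows "homog (r + s) (\<lambda>k. if int k + r \<ge> 0 then u k * v (nat (int k + r)) else 0) (T * U)"
  unfolding homog_def
proof (intro allI)
  fix n k
  define j where "j = nat (int k + r)"
  have "dmat (T * U) n k = (\<Sum>i<k + nat \<bar>r\<bar> + 1. dmat T i k * dmat U n i)"
    by (rule dmat_mult) (auto simp: homogD[OF T])
  also have "\<dots> = (\<Sum>i<k + nat \<bar>r\<bar> + 1. if i = j \<and> int k + r \<ge> 0 then u k * dmat U n j else 0)"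
    by (intro sum.cong refl) (auto simp: homogD[OF T] j_def)
  also have "\<dots> = (if int k + r \<ge> 0 then u k * dmat U n j else 0)"
    by (auto simp: j_def)
  also have "\<dots> = (if int n - int k = r + s then if int k + r \<ge> 0 then u k * v j else 0 else 0)"
    by (auto simp: homogD[OF U] j_def)
  finally show "dmat (T * U) n k = (if int n - int k = r + s
      then if int k + r \<ge> 0 then u k * v (nat (int k + r)) else 0 else 0)"
    unfolding j_def .
qed

lemma homog_cong:
  assumes "homog r u T" "\<And>k. int k + r \<ge> 0 \<Longrightarrow> u k = v k"
  shows "homog r v T"
  unfolding homog_def
proof (intro allI)
  fix n k
  show "dmat T n k = (if int n - int k = r then v k else 0)"
    using homogD[OF assms(1), of n k] assms(2)[of k] by auto
qed

lemma homog_unique: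
  assumes "homog r u T" "homog r v T" "int k + r \<ge> 0"
  shows "u k = v k"
  using homogD[OF assms(1), of "nat (int k + r)" k] homogD[OF assms(2), of "nat (int k + r)" k] assms(3)
  by simp

lemma homog_eqI:
  assumes "homog r u T" "homog r u U" shows "T = U"
  by (rule dmat_eqI) (simp add: homogD[OF assms(1)] homogD[OF assms(2)])

lemma homog_0: "homog r (\<lambda>_. 0) 0" by (simp add: homog_def dmat_0)

lemma homog_add: "homog r u T \<Longrightarrow> homog r v U \<Longrightarrow> homog r (\<lambda>k. u k + v k) (T + U)"
  by (simp add: homog_def dmat_add)

lemma homog_sum:
  "(\<And>i. i \<in> I \<Longrightarrow> homog r (u i) (T i)) \<Longrightarrow> homog r (\<lambda>k. \<Sum>i\<in>I. u i k) (\<Sum>i\<in>I. T i)"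
  by (induction I rule: infinite_finite_induct) (auto intro: homog_0 homog_add)

lemma homog_const_mult: "homog r u T \<Longrightarrow> homog r (\<lambda>k. c * u k) (dsym_const c * T)"
  by (simp add: homog_def dmat_const_mult)

lemma homog_1: "homog 0 (\<lambda>_. 1) 1"
  by (simp add: homog_def dmat_1)

lemma homog_0_mult: "homog 0 u T \<Longrightarrow> homog r v U \<Longrightarrow> homog r (\<lambda>k. u k * v k) (T * U)"
  using homog_mult[of 0 u T r v U] by simp

lemma homog_0_power: "homog 0 u T \<Longrightarrow> homog 0 (\<lambda>k. u k ^ l) (T ^ l)"
  by (induction l) (auto intro: homog_1 homog_0_mult)

lemma homog_diff: "homog 1 (\<lambda>_. 1) dsym_diff"
  unfolding homog_def
proof (intro allI)
  fix n k
  have "fps_deriv (fps_X ^ n :: 'a fps) $ k = (if n = Suc k then of_nat n else 0)"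
    by (auto simp: fps_X_power_nth)
  then show "dmat (dsym_diff :: 'a dsym) n k = (if int n - int k = 1 then 1 else 0)"
    by (cases "n = Suc k") (auto simp: dmat_act dsym_act_diff simp del: fps_deriv_nth of_nat_Suc)
qed

lemma homog_x: "homog (- 1) of_nat dsym_x"
  unfolding homog_def
proof (intro allI)
  fix n k
  show "dmat (dsym_x :: 'a dsym) n k = (if int n - int k = - 1 then of_nat k else 0)"
    by (cases k) (auto simp: dmat_act dsym_act_mult dsym_x_def dsym_act_fun fps_X_power_nth)
qed

lemma homog_diff_power: "homog (int r) (\<lambda>_. 1) (dsym_diff ^ r :: 'a::field_char_0 dsym)"
proof (induction r)
  case (Suc r)
  have "homog (1 + int r) (\<lambda>_. 1) (dsym_diff * dsym_diff ^ r :: 'a dsym)"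
    by (rule homog_cong[OF homog_mult[OF homog_diff Suc]]) auto
  then show ?case by (simp add: add.commute)
qed (auto simp: homog_1)

text \<open>
  \<open>exp(c x*\<partial>)\<close> is the substitution \<open>x \<mapsto> (c + 1) x\<close>.
\<close>

lemma homog_exp: "homog 0 (\<lambda>k. (c + 1) ^ k) (dsym_exp c)"
  unfolding homog_def
proof (intro allI)
  fix n k
  have "dmat (dsym_exp c) n k = (\<Sum>i\<le>k. if n = k then c ^ i * of_nat (k choose i) else 0)"
    unfolding dmat_def by (intro sum.cong) (auto simp: dsym_exp.rep_eq fps_X_power_nth)
  then show "dmat (dsym_exp c) n k = (if int n - int k = 0 then (c + 1) ^ k else 0)"
    by (auto simp: binomial_ring mult.commute)
qed

text \<open>
  \<open>\<integral>\<close> is integration with constant term \<open>0\<close>, by the alternating sum of binomial coefficients.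
\<close>

lemma homog_int: "homog (- 1) (\<lambda>_. 1) dsym_int"
  unfolding homog_def
proof (intro allI)
  fix n k
  have "dmat (dsym_int :: 'a dsym) n k = (\<Sum>i\<le>k. if k = Suc n then (if i = 0 then 0 else - ((- 1) ^ i * of_nat (k choose i))) else 0)"
    unfolding dmat_def
  proof (intro sum.cong refl)
    fix i
    show "(if k \<le> i + n then dsym_coeff dsym_int (i + n - k) $ i * (fact i * of_nat (k choose i)) else 0)
      = (if k = Suc n then (if i = 0 then 0 else - ((- 1) ^ i * of_nat (k choose i))) else 0 :: 'a)"
    proof (cases "k = Suc n \<and> i \<noteq> 0")
      case True
      then obtain l where "i = Suc l" by (cases i) auto
      then show ?thesis using True by (simp add: dsym_int.rep_eq fps_X_power_nth del: fact_Suc)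
    next
      case False
      then show ?thesis by (auto simp: dsym_int.rep_eq fps_X_power_nth simp del: power_Suc fact_Suc)
    qed
  qed
  also have "\<dots> = (if k = Suc n then 1 - (\<Sum>i\<le>k. (- 1) ^ i * of_nat (k choose i)) else 0)"
    by (auto simp: sum.atMost_shift sum_negf simp del: sum.atMost_Suc)
  also have "\<dots> = (if k = Suc n then 1 else 0)"
    by (auto simp: choose_alternating_sum simp del: sum.atMost_Suc)
  finally show "dmat (dsym_int :: 'a dsym) n k = (if int n - int k = - 1 then 1 else 0)"
    by auto
qed

lemma homog_int_power: "homog (- int r) (\<lambda>_. 1) (dsym_int ^ r :: 'a::field_char_0 dsym)"
proof (induction r)
  case (Suc r)
  have "homog (- 1 + - int r) (\<lambda>_. 1) (dsym_int * dsym_int ^ r :: 'a dsym)"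
    by (rule homog_cong[OF homog_mult[OF homog_int Suc]]) auto
  then show ?case by (simp add: add.commute)
qed (auto simp: homog_1)

lemma homog_D: "homog r (\<lambda>_. 1) (dsym_D r)"
  using homog_diff_power[of "nat r"] homog_int_power[of "nat (- r)"] by (auto simp: dsym_D_def)

lemma homog_Gamma: "homog 0 (\<lambda>k. of_nat k ^ l) (dsym_Gamma l :: 'a::field_char_0 dsym)"
proof -
  have "homog (- 1 + 1) of_nat (dsym_x * dsym_diff :: 'a dsym)"
    by (rule homog_cong[OF homog_mult[OF homog_x homog_diff]]) (auto simp: Suc_le_eq)
  then show ?thesis unfolding dsym_Gamma_def by (intro homog_0_power) simp
qed

lemma homog_A: "homog 0 (\<lambda>k. \<xi> ^ (i * k)) (dsym_A \<xi> i)"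
  using homog_exp[of "\<xi> ^ i - 1"] by (simp add: dsym_A_def power_mult)

lemma homog_x_power: "\<exists>u. homog (- int r) u (dsym_x ^ r :: 'a::field_char_0 dsym)"
proof (induction r)
  case (Suc r)
  then obtain u where "homog (- int r) u (dsym_x ^ r :: 'a dsym)" by blast
  from homog_mult[OF homog_x this] show ?case by (auto simp: algebra_simps)
qed (use homog_1 in auto)

text \<open>
  As \<open>\<delta>\<close> evaluates at \<open>0\<close>, the operator \<open>B_j\<close> is a projection onto one monomial, so it does not
  influence a diagonal at large \<open>k\<close>.  The condition \<open>k > 0\<close> covers the index \<open>j = 0\<close>, for which
  \<open>j - 1 = 0\<close>.
\<close>

lemma homog_B: "\<exists>u. homog 0 u (dsym_B j :: 'a::field_char_0 dsym) \<and> (\<forall>k\<ge>j. k > 0 \<longrightarrow> u k = 0)"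
proof -
  let ?r = "j - 1"
  obtain u where u: "homog (- int ?r) u (dsym_x ^ ?r :: 'a dsym)" using homog_x_power by blast
  have d: "homog 0 (\<lambda>k. 0 ^ k) (dsym_delta :: 'a dsym)" using homog_exp[of "- 1 :: 'a"] by (simp add: dsym_delta_def)
  have "homog (int ?r) (\<lambda>k. 0 ^ k * 1) (dsym_delta * dsym_diff ^ ?r :: 'a dsym)"
    by (intro homog_0_mult d homog_diff_power)
  from homog_mult[OF homog_const_mult[OF u, of "1 / fact ?r"] this]
  have "homog 0 (\<lambda>k. if k \<ge> ?r then 1 / fact ?r * u k * 0 ^ (k - ?r) else 0) (dsym_B j :: 'a dsym)"
    unfolding dsym_B_def
    by (auto simp: mult.assoc nat_diff_distrib elim!: homog_cong)
  then show ?thesis by (intro exI conjI) (assumption, auto simp: power_0_left)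
qed

text \<open>
  The component of order \<open>r\<close> as a function of the row, extended by \<open>0\<close> to the rows without an entry.
  With this extension the commutator with \<open>\<partial>^q\<close> becomes a difference without boundary terms.
\<close>

definition diag :: "'a::field_char_0 dsym \<Rightarrow> int \<Rightarrow> nat \<Rightarrow> 'a" where
  "diag T r m = (if int m + r \<ge> 0 then dmat T (nat (int m + r)) m else 0)"

lemma homog_hcomp: "homog r (diag T r) (dsym_hcomp T r)"
  by (auto simp: homog_def dmat_hcomp diag_def)

text \<open>
  Dictionary between HCPs and functions: \<open>\<Gamma>_l A_i D^r\<close> has \<open>k^l \<xi>^(i k)\<close> on the diagonal \<open>r\<close>, and
  the \<open>B_j\<close> change finitely many entries.
\<close>

lemma G_form_homog:
  assumes "G_form \<iota> q \<xi> r d N f g H"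
  shows "\<exists>b. homog r (\<lambda>k. (\<Sum>i<q. \<Sum>l\<le>d i. f l i * \<xi> ^ (i * k) * of_nat k ^ l) + b k) H \<and> (\<forall>k>N. b k = 0)"
proof -
  have H: "H = ((\<Sum>i<q. \<Sum>l\<le>d i. dsym_const (f l i) * dsym_Gamma l * dsym_A \<xi> i)
          + (\<Sum>j=1..N. dsym_const (g j) * dsym_B j)) * dsym_D r"
    using assms by (simp add: G_form_def)
  obtain u where u: "\<And>j. homog 0 (u j) (dsym_B j :: 'b dsym)" "\<And>j k. k \<ge> j \<Longrightarrow> k > 0 \<Longrightarrow> u j k = 0"
    using homog_B by metis
  have "homog 0 (\<lambda>k. \<Sum>j=1..N. g j * u j k) (\<Sum>j=1..N. dsym_const (g j) * dsym_B j)"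
    by (intro homog_sum homog_const_mult u)
  moreover have "homog 0 (\<lambda>k. \<Sum>i<q. \<Sum>l\<le>d i. f l i * of_nat k ^ l * \<xi> ^ (i * k))
      (\<Sum>i<q. \<Sum>l\<le>d i. dsym_const (f l i) * dsym_Gamma l * dsym_A \<xi> i)"
    by (intro homog_sum homog_0_mult homog_const_mult homog_Gamma homog_A)
  ultimately have "homog r (\<lambda>k. ((\<Sum>i<q. \<Sum>l\<le>d i. f l i * of_nat k ^ l * \<xi> ^ (i * k))
      + (\<Sum>j=1..N. g j * u j k)) * 1) H"
    unfolding H by (intro homog_0_mult homog_add homog_D)
  then have "homog r (\<lambda>k. (\<Sum>i<q. \<Sum>l\<le>d i. f l i * \<xi> ^ (i * k) * of_nat k ^ l) + (\<Sum>j=1..N. g j * u j k)) H"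
    by (simp add: ac_simps)
  moreover have "(\<Sum>j=1..N. g j * u j k) = 0" if "k > N" for k
    using that u(2) by (intro sum.neutral) auto
  ultimately show ?thesis by (intro exI[of _ "\<lambda>k. \<Sum>j=1..N. g j * u j k"]) simp
qed

lemma G_formI:
  assumes "\<And>l i. f l i \<in> adjoin \<iota> \<xi>" "0 \<in> adjoin \<iota> \<xi>"
    and "homog r (\<lambda>k. \<Sum>l\<le>L. \<Sum>i<q. f l i * \<xi> ^ (i * k) * of_nat k ^ l) H"
  shows "G_form \<iota> q \<xi> r (\<lambda>_. L) 0 f (\<lambda>_. 0) H"
proof -
  let ?G = "(\<Sum>i<q. \<Sum>l\<le>L. dsym_const (f l i) * dsym_Gamma l * dsym_A \<xi> i) * dsym_D r"
  have "homog r (\<lambda>k. (\<Sum>i<q. \<Sum>l\<le>L. f l i * of_nat k ^ l * \<xi> ^ (i * k)) * 1) ?G"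
    by (intro homog_sum homog_0_mult homog_const_mult homog_Gamma homog_A homog_D)
  moreover have "(\<Sum>i<q. \<Sum>l\<le>L. f l i * of_nat k ^ l * \<xi> ^ (i * k)) * 1
      = (\<Sum>l\<le>L. \<Sum>i<q. f l i * \<xi> ^ (i * k) * of_nat k ^ l)" for k
    by (subst sum.swap) (simp add: ac_simps)
  ultimately have "H = ?G" using assms(3) homog_eqI by simp
  then show ?thesis using assms(1,2) by (simp add: G_form_def)
qed

lemma diag_map: "field_embedding \<iota> \<Longrightarrow> diag (dsym_map \<iota> T) r m = \<iota> (diag T r m)"
  by (simp add: diag_def dmat_map field_embedding_of_nat)

lemma fdiff_pow_embedding:
  fixes \<iota> :: "'a::field_char_0 \<Rightarrow> 'b::field_char_0"
  assumes "field_embedding \<iota>"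
  shows "(fdiff q ^^ k) (\<lambda>m. \<iota> (h m)) m = \<iota> ((fdiff q ^^ k) h m)"
proof -
  have "\<iota> (x - y) = \<iota> x - \<iota> y" for x y
  proof -
    have "\<iota> (x - y + y) = \<iota> (x - y) + \<iota> y"
      using assms unfolding field_embedding_def by blast
    then show ?thesis by (simp add: eq_diff_eq)
  qed
  then show ?thesis by (induction k arbitrary: m) (auto simp: fdiff_def)
qed

lemma field_embedding_eq_0:
  fixes \<iota> :: "'a::field_char_0 \<Rightarrow> 'b::field_char_0"
  assumes "field_embedding \<iota>" shows "\<iota> x = 0 \<longleftrightarrow> x = 0"
proof
  assume "\<iota> x = 0"
  show "x = 0"
  proof (rule ccontr)
    assume "x \<noteq> 0"
    then have "\<iota> (x * inverse x) = 1" using assms by (simp add: field_embedding_def)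
    moreover have "\<iota> (x * inverse x) = \<iota> x * \<iota> (inverse x)"
      using assms unfolding field_embedding_def by blast
    ultimately show False using \<open>\<iota> x = 0\<close> by simp
  qed
qed (simp add: field_embedding_of_nat[OF assms])

text \<open>
  From points to degrees.  Vanishing of some difference exhibits the component as an HCP without
  \<open>B_j\<close>; the coefficients of this particular G-form give points of \<open>E\<close>, so they are subject to
  whatever bound holds on \<open>E\<close>.
\<close>

lemma fdiff_diag_eq_0_of_points:
  fixes \<iota> :: "'a::field_char_0 \<Rightarrow> 'b::field_char_0"
  assumes emb: "field_embedding \<iota>" and prim: "primitive_root_of_unity q \<xi>"
    and L: "\<And>m. (fdiff q ^^ L) (diag T r) m = 0"
    and k: "\<And>l. (l, r) \<in> dsym_E \<iota> q \<xi> (dsym_map \<iota> T) \<Longrightarrow> l < k"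
  shows "(fdiff q ^^ k) (diag T r) m = 0"
proof -
  let ?h = "\<lambda>m. \<iota> (diag T r m)"
  have d: "diag (dsym_map \<iota> T) r = ?h" by (rule ext) (rule diag_map[OF emb])
  have h0: "(fdiff q ^^ Suc L) ?h m = 0" for m
    unfolding fdiff_pow_embedding[OF emb] fdiff_pow_Suc by (simp add: L field_embedding_of_nat[OF emb])
  obtain f where f: "\<And>l i. f l i \<in> adjoin \<iota> \<xi>"
    "\<And>m. ?h m = (\<Sum>l<Suc L. \<Sum>i<q. f l i * \<xi> ^ (i * m) * of_nat m ^ l)"
    using exponential_polynomial_of_fdiff[OF emb prim h0 adjoin_base[OF emb]] by blast
  have he: "?h = (\<lambda>m. \<Sum>l\<le>L. \<Sum>i<q. f l i * \<xi> ^ (i * m) * of_nat m ^ l)"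
    by (rule ext) (simp only: f(2) lessThan_Suc_atMost)
  have G: "G_form \<iota> q \<xi> r (\<lambda>_. L) 0 f (\<lambda>_. 0) (dsym_hcomp (dsym_map \<iota> T) r)"
    using homog_hcomp[of r "dsym_map \<iota> T"] unfolding d he by (rule G_formI[OF f(1) adjoin_0[OF emb]])
  have E: "(l, r) \<in> dsym_E \<iota> q \<xi> (dsym_map \<iota> T)" if "f l i \<noteq> 0" "l \<le> L" "i < q" for l i
  proof -
    have "(l, r) \<in> hcp_points \<iota> q \<xi> r (dsym_hcomp (dsym_map \<iota> T) r)"
      unfolding hcp_points_def using G that by blast
    then show ?thesis unfolding dsym_E_def by blast
  qed
  have lk: "l < k" if "f l i \<noteq> 0" "l \<le> L" "i < q" for l i
    by (rule k[OF E[OF that]])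
  have "\<iota> ((fdiff q ^^ k) (diag T r) m) = (fdiff q ^^ k) ?h m"
    by (rule fdiff_pow_embedding[OF emb, symmetric])
  also have "\<dots> = (\<Sum>l<Suc L. \<Sum>i<q. f l i * \<xi> ^ (i * m) * (fdiff q ^^ k) (\<lambda>m. of_nat m ^ l) m)"
    unfolding f(2) by (rule fdiff_pow_exponential_polynomial[OF prim])
  also have "\<dots> = 0"
  proof (intro sum.neutral ballI)
    fix l i assume "l \<in> {..<Suc L}" "i \<in> {..<q}"
    then show "f l i * \<xi> ^ (i * m) * (fdiff q ^^ k) (\<lambda>m. of_nat m ^ l) m = 0"
      using lk[of l i] by (cases "f l i = 0") (auto simp: fdiff_pow_power)
  qed
  finally show ?thesis by (simp add: field_embedding_eq_0[OF emb])
qed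

text \<open>
  From degrees to points: a point \<open>(l, r)\<close> comes from a nonzero coefficient of some G-form, and the
  component of order \<open>r\<close> then has degree at least \<open>l\<close>.
\<close>

lemma point_imp_fdiff_diag_neq_0:
  fixes \<iota> :: "'a::field_char_0 \<Rightarrow> 'b::field_char_0"
  assumes emb: "field_embedding \<iota>" and prim: "primitive_root_of_unity q \<xi>"
    and E: "(l, r) \<in> dsym_E \<iota> q \<xi> (dsym_map \<iota> T)"
  shows "\<exists>k\<ge>l. \<exists>m. (fdiff q ^^ k) (diag T r) m \<noteq> 0"
proof (rule ccontr)
  assume "\<not> ?thesis"
  then have vanish: "(fdiff q ^^ k) (diag T r) m = 0" if "k \<ge> l" for k m using that by blast
  let ?h = "\<lambda>m. \<iota> (diag T r m)"
  have d: "diag (dsym_map \<iota> T) r = ?h" by (rule ext) (rule diag_map[OF emb])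
  from E have "(l, r) \<in> hcp_points \<iota> q \<xi> r (dsym_hcomp (dsym_map \<iota> T) r)"
    unfolding dsym_E_def hcp_points_def by auto
  then obtain d N f g i where G: "G_form \<iota> q \<xi> r d N f g (dsym_hcomp (dsym_map \<iota> T) r)"
    and fi: "i < q" "l \<le> d i" "f l i \<noteq> 0"
    unfolding hcp_points_def by auto
  from G_form_homog[OF G] obtain b where
    b: "homog r (\<lambda>k. (\<Sum>i<q. \<Sum>l\<le>d i. f l i * \<xi> ^ (i * k) * of_nat k ^ l) + b k)
      (dsym_hcomp (dsym_map \<iota> T) r)" "\<And>k. k > N \<Longrightarrow> b k = 0" by blast
  define D where "D = (\<Sum>i<q. d i)"
  have D: "d i \<le> D" if "i < q" for i
    unfolding D_def using that by (intro member_le_sum) auto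
  define f' where "f' l i = (if l \<le> d i then f l i else 0)" for l i
  have "?h m = (\<Sum>l\<le>D. \<Sum>i<q. f' l i * \<xi> ^ (i * m) * of_nat m ^ l)" if "m > N + nat \<bar>r\<bar>" for m
  proof -
    have "?h m = (\<Sum>i<q. \<Sum>l\<le>d i. f l i * \<xi> ^ (i * m) * of_nat m ^ l)"
      using homog_unique[OF homog_hcomp b(1), of m] b(2)[of m] that by (simp add: d)
    also have "\<dots> = (\<Sum>i<q. \<Sum>l\<le>D. f' l i * \<xi> ^ (i * m) * of_nat m ^ l)"
      using D by (intro sum.cong refl sum.mono_neutral_cong_left) (auto simp: f'_def)
    finally show ?thesis by (subst sum.swap)
  qed
  then have "\<forall>\<^sub>F m in sequentially. ?h m = (\<Sum>l\<le>D. \<Sum>i<q. f' l i * \<xi> ^ (i * m) * of_nat m ^ l)"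
    using eventually_gt_at_top[of "N + nat \<bar>r\<bar>"] by (rule eventually_mono[rotated])
  moreover have "\<forall>\<^sub>F m in sequentially. (fdiff q ^^ k) ?h m = 0" if "k \<ge> l" for k
    unfolding fdiff_pow_embedding[OF emb] by (simp add: vanish that field_embedding_of_nat[OF emb])
  moreover have "l \<le> D" using fi D[of i] by simp
  ultimately have "f' l i = 0"
    using fi(1) by (rule exponential_polynomial_degree[OF prim _ _ order_refl])
  then show False using fi by (simp add: f'_def)
qed

section \<open>Differential operators, order and commutators\<close>

lemma coeff_mult_top:
  assumes P: "\<And>s. s > d \<Longrightarrow> dsym_coeff P s = 0" and Q: "\<And>s. s > e \<Longrightarrow> dsym_coeff Q s = 0"
    and n: "n \<ge> d + e"
  shows "dsym_coeff (P * Q) n = (if n = d + e then dsym_coeff P d * dsym_coeff Q e else 0)"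
proof -
  define t where "t j i = of_nat ((i + j) choose i) * dsym_coeff P (i + j)
      * fps_nth_deriv i (dsym_coeff Q (n - j))" for j i
  have t0: "t j i = 0" if "\<not> (n = d + e \<and> j = d \<and> i = 0)" "j \<le> n" for i j
  proof (cases "i + j > d")
    case False
    then have "n - j > e" using that n by auto
    then show ?thesis by (simp add: t_def Q)
  qed (simp add: t_def P)
  have row: "(\<Sum>i. t j i) = (if j = d then if n = d + e then dsym_coeff P d * dsym_coeff Q e else 0 else 0)"
    if "j \<le> n" for j
  proof -
    have "(\<Sum>i. t j i) = (\<Sum>i\<in>{0}. t j i)"
      by (rule suminf_finite) (use t0 that in auto)
    also have "\<dots> = t j 0" by simp
    also have "t j 0 = (if j = d then if n = d + e then dsym_coeff P d * dsym_coeff Q e else 0 else 0)"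
    proof (cases "n = d + e \<and> j = d")
      case False
      then have "t j 0 = 0" using that by (intro t0) auto
      with False show ?thesis by auto
    qed (simp add: t_def)
    finally show ?thesis .
  qed
  have "dsym_coeff (P * Q) n = (\<Sum>j\<le>n. \<Sum>i. t j i)"
    unfolding times_dsym.rep_eq coeffs_times_def t_def ..
  also have "\<dots> = (\<Sum>j\<le>n. if j = d then if n = d + e then dsym_coeff P d * dsym_coeff Q e else 0 else 0)"
    using row by (intro sum.cong) simp_all
  also have "\<dots> = (if n = d + e then dsym_coeff P d * dsym_coeff Q e else 0)"
    using n by (simp only: sum.delta finite_atMost) auto
  finally show ?thesis .
qed

definition ad :: "'a::field_char_0 dsym \<Rightarrow> 'a dsym \<Rightarrow> 'a dsym" where
  "ad Q T = Q * T - T * Q"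

lemma coeff_diff: "dsym_coeff (P - Q) s = dsym_coeff P s - dsym_coeff Q s"
  unfolding minus_dsym_def plus_dsym.rep_eq uminus_dsym.rep_eq by simp

text \<open>
  The leading coefficients are power series and commute, so they cancel in the commutator and the
  degree drops below the sum of the degrees.
\<close>

lemma coeff_ad:
  assumes T: "\<And>s. s > d \<Longrightarrow> dsym_coeff T s = 0" and Q: "\<And>s. s > q \<Longrightarrow> dsym_coeff Q s = 0"
    and "q > 0" "s > d + (q - 1)"
  shows "dsym_coeff (ad Q T) s = 0"
proof -
  have "s \<ge> q + d" "s \<ge> d + q" using assms by auto
  from coeff_mult_top[OF Q T this(1)] coeff_mult_top[OF T Q this(2)] show ?thesis
    unfolding ad_def coeff_diff by (simp add: ac_simps)
qed

lemma coeff_ad_pow: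
  assumes "\<And>s. s > p \<Longrightarrow> dsym_coeff P s = 0" and "\<And>s. s > q \<Longrightarrow> dsym_coeff Q s = 0"
    and "q > 0" "s > p + l * (q - 1)"
  shows "dsym_coeff ((ad Q ^^ l) P) s = 0"
  using assms(4)
proof (induction l arbitrary: s)
  case (Suc l)
  show ?case
    unfolding funpow.simps comp_apply
  proof (rule coeff_ad[OF Suc.IH assms(2,3)])
    show "s > p + l * (q - 1) + (q - 1)" using Suc.prems by (simp only: mult_Suc ac_simps)
  qed
qed (use assms in simp)

lemma diag_coeff:
  assumes "\<And>s. s > d \<Longrightarrow> dsym_coeff T s = 0" and "int d - r \<le> int N"
  shows "diag T r m = (\<Sum>i\<le>N. (if int i + r \<ge> 0 then dsym_coeff T (nat (int i + r)) $ i else 0)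
    * (fact i * of_nat (m choose i)))"
proof -
  define t where "t i = (if int i + r \<ge> 0 then dsym_coeff T (nat (int i + r)) $ i else 0)
    * (fact i * of_nat (m choose i))" for i
  have tN: "t i = 0" if "i > N" for i
  proof -
    have "int i + r < 0 \<or> nat (int i + r) > d" using that assms(2) by linarith
    then show ?thesis using assms(1) by (auto simp: t_def)
  qed
  have tm: "t i = 0" if "i > m" for i using that by (simp add: t_def binomial_eq_0)
  have "(\<Sum>i\<le>N. t i) = (\<Sum>i\<le>max m N. t i)"
    by (rule sum.mono_neutral_left) (auto simp: not_le intro: tN)
  moreover have "(\<Sum>i\<le>m. t i) = (\<Sum>i\<le>max m N. t i)"
    by (rule sum.mono_neutral_left) (auto simp: not_le intro: tm)
  moreover have "diag T r m = (\<Sum>i\<le>m. t i)"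
  proof (cases "int m + r \<ge> 0")
    case True
    define n where "n = nat (int m + r)"
    have e: "int i + r \<ge> 0 \<longleftrightarrow> m \<le> i + n" "nat (int i + r) = i + n - m" for i
      using True unfolding n_def by linarith+
    have "diag T r m = dmat T n m" using True by (simp add: diag_def n_def)
    also have "\<dots> = (\<Sum>i\<le>m. t i)"
      unfolding dmat_def t_def e by (intro sum.cong) simp_all
    finally show ?thesis .
  next
    case False
    have "t i = 0" if "i \<le> m" for i using False that by (simp add: t_def)
    then show ?thesis using False by (simp add: diag_def)
  qed
  ultimately show ?thesis unfolding t_def by simp
qed

lemma diag_eq_0_of_coeff:
  assumes "\<And>s. s > d \<Longrightarrow> dsym_coeff T s = 0" and "r > int d"
  shows "diag T r m = 0"
  using diag_coeff[OF assms(1), where r = r and N = 0 and m = m] assms by auto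

text \<open>
  A differential operator of finite degree has on each diagonal finitely many terms \<open>x^i \<partial>^s\<close>, and
  each contributes a falling factorial in the row.
\<close>

lemma diag_polynomial:
  assumes "\<And>s. s > d \<Longrightarrow> dsym_coeff T s = 0"
  shows "\<exists>R. \<forall>m. diag T r m = poly R (of_nat m)"
proof -
  define N where "N = nat (int d - r)"
  define c where "c i = (if int i + r \<ge> 0 then dsym_coeff T (nat (int i + r)) $ i else 0)" for i
  have "fact i * of_nat (m choose i) = poly (\<Prod>j=0..<i. [:- of_nat j, 1:]) (of_nat m :: 'a)" for i m
    unfolding binomial_gbinomial gbinomial_mult_fact poly_prod by simp
  moreover have "diag T r m = (\<Sum>i\<le>N. c i * (fact i * of_nat (m choose i)))" for m
    unfolding c_def by (rule diag_coeff[OF assms]) (assumption, unfold N_def, linarith)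
  ultimately have "diag T r m = poly (\<Sum>i\<le>N. smult (c i) (\<Prod>j=0..<i. [:- of_nat j, 1:])) (of_nat m)" for m
    by (simp only: poly_sum poly_smult)
  then show ?thesis by blast
qed

lemma periodic_polynomial_constant:
  fixes R :: "'a::field_char_0 poly"
  assumes "\<And>m. poly R (of_nat (m + q)) = poly R (of_nat m)" "q > 0"
  shows "poly R x = poly R 0"
proof -
  have "poly R (of_nat (k * q)) = poly R 0" for k
  proof (induction k)
    case (Suc k)
    then show ?case using assms(1)[of "k * q"] by (simp add: add.commute)
  qed simp
  then have "range (\<lambda>k. of_nat (k * q)) \<subseteq> {x. poly (R - [:poly R 0:]) x = 0}" by auto
  moreover have "infinite (range (\<lambda>k. of_nat (k * q) :: 'a))"
    using assms(2) by (intro range_inj_infinite) (auto simp: inj_def simp flip: of_nat_mult)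
  ultimately have "R - [:poly R 0:] = 0" using poly_roots_finite finite_subset by blast
  then have "poly (R - [:poly R 0:]) x = 0" by simp
  then show ?thesis by simp
qed

text \<open>
  The order of \<open>T\<close> is at most \<open>a\<close>.
\<close>

definition upper :: "int \<Rightarrow> 'a::field_char_0 dsym \<Rightarrow> bool" where
  "upper a T \<longleftrightarrow> (\<forall>n k. int n - int k > a \<longrightarrow> dmat T n k = 0)"

lemma upper_diag: "upper a T \<longleftrightarrow> (\<forall>r>a. \<forall>m. diag T r m = 0)"
proof
  assume *: "\<forall>r>a. \<forall>m. diag T r m = 0"
  show "upper a T" unfolding upper_def
  proof (intro allI impI)
    fix n k assume "int n - int k > a"
    then have "diag T (int n - int k) k = 0" using * by blast
    then show "dmat T n k = 0" by (simp add: diag_def)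
  qed
qed (auto simp: upper_def diag_def)

lemma upper_mult_diag:
  assumes T: "upper a T" and U: "upper b U" and r: "r \<ge> a + b"
  shows "diag (T * U) r m = (if r = a + b \<and> int m + a \<ge> 0 then diag T a m * diag U b (nat (int m + a)) else 0)"
proof (cases "int m + r \<ge> 0")
  case True
  define n where "n = nat (int m + r)"
  have T0: "dmat T j m = 0" if "int j - int m > a" for j using T that by (simp add: upper_def)
  have U0: "dmat U n j = 0" if "int n - int j > b" for j using U that by (simp add: upper_def)
  have "diag (T * U) r m = (\<Sum>j<nat (int m + a) + 1. dmat T j m * dmat U n j)"
    using True unfolding diag_def n_def[symmetric]
    by (simp del: sum.lessThan_Suc, intro dmat_mult T0) linarith
  also have "\<dots> = (\<Sum>j<nat (int m + a) + 1. if j = nat (int m + a) then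
      (if r = a + b \<and> int m + a \<ge> 0 then dmat T j m * dmat U n j else 0) else 0)"
  proof (intro sum.cong refl)
    fix j
    show "dmat T j m * dmat U n j = (if j = nat (int m + a) then
      (if r = a + b \<and> int m + a \<ge> 0 then dmat T j m * dmat U n j else 0) else 0)"
    proof (cases "int j - int m > a \<or> int n - int j > b")
      case False
      then have "int j = int m + a" "r = a + b" using r True by (auto simp: n_def)
      then show ?thesis by auto
    qed (use T0 U0 in auto)
  qed
  also have "\<dots> = (if r = a + b \<and> int m + a \<ge> 0 then diag T a m * diag U b (nat (int m + a)) else 0)"
    using True by (auto simp: diag_def n_def add.assoc simp del: sum.lessThan_Suc)
  finally show ?thesis .
qed (use r in \<open>auto simp: diag_def\<close>)

lemma upper_mult: "upper a T \<Longrightarrow> upper b U \<Longrightarrow> upper (a + b) (T * U)"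
  by (subst upper_diag) (auto simp: upper_mult_diag)

text \<open>
  Conjugation by operators \<open>1 + (terms of negative order)\<close> preserves the highest component.
\<close>

lemma upper_conjugate:
  assumes S: "upper 0 S" "\<And>m. diag S 0 m = 1" and U: "upper 0 U" "\<And>m. diag U 0 m = 1"
    and T: "upper a T"
  shows "upper a (S * T * U)" "diag (S * T * U) a m = diag T a m"
proof -
  have ST: "upper a (S * T)" using upper_mult[OF S(1) T] by simp
  show "upper a (S * T * U)" using upper_mult[OF ST U(1)] by simp
  have "diag (S * T) a m = diag T a m"
    using upper_mult_diag[OF S(1) T, of a m] S(2) by simp
  then show "diag (S * T * U) a m = diag T a m"
    using upper_mult_diag[OF ST U(1), of a m] U(2) by (auto simp: diag_def)
qed

text \<open>
  Forward substitution for a unitriangular matrix.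
\<close>

lemma upper_inverse:
  assumes S: "upper 0 S" "\<And>m. diag S 0 m = 1" and inv: "S * U = 1"
  shows "upper 0 U" "diag U 0 m = 1"
proof -
  have eq: "(if n = k then 1 else 0) = (\<Sum>j<k. dmat S j k * dmat U n j) + dmat U n k" for n k
  proof -
    have "dmat (S * U) n k = (\<Sum>j<Suc k. dmat S j k * dmat U n j)"
      using S(1) by (intro dmat_mult) (auto simp: upper_def)
    then show ?thesis using S(2)[of k] by (simp add: inv dmat_1 diag_def)
  qed
  have z: "dmat U n k = 0" if "n > k" for n k
    using that
  proof (induction k rule: less_induct)
    case (less k)
    then have "(\<Sum>j<k. dmat S j k * dmat U n j) = 0" by (intro sum.neutral) auto
    then show ?case using eq[of n k] less.prems by simp
  qed
  then show "upper 0 U" by (auto simp: upper_def)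
  have "(\<Sum>j<m. dmat S j m * dmat U m j) = 0" using z by (intro sum.neutral) auto
  then show "diag U 0 m = 1" using eq[of m m] by (simp add: diag_def)
qed

text \<open>
  In the basis of divided powers \<open>\<partial>^q\<close> is the pure shift by \<open>q\<close>, so the commutator compares entries of
  the same diagonal at distance \<open>q\<close>.
\<close>

lemma diag_ad_diff_power:
  "diag (ad (dsym_diff ^ q) T) (r + int q) m = fdiff q (diag T r) m"
proof -
  let ?D = "dsym_diff ^ q :: 'a dsym"
  have D: "dmat ?D n k = (if n = k + q then 1 else 0)" for n k
    using homogD[OF homog_diff_power[of q], where 'a = 'a, of n k] by auto
  have 1: "dmat (?D * T) n k = dmat T n (k + q)" for n k
  proof -
    have "dmat (?D * T) n k = (\<Sum>j<k + q + 1. dmat ?D j k * dmat T n j)"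
      by (rule dmat_mult) (auto simp: D)
    also have "\<dots> = (\<Sum>j<k + q + 1. if j = k + q then dmat T n j else 0)"
      by (intro sum.cong) (auto simp: D)
    finally show ?thesis by simp
  qed
  obtain M where M: "\<And>n k. n > k + M \<Longrightarrow> dmat T n k = 0" using dmat_bounded by blast
  have 2: "dmat (T * ?D) n k = (if n \<ge> q then dmat T (n - q) k else 0)" for n k
  proof -
    have "dmat (T * ?D) n k = (\<Sum>j<k + M + n + 1. dmat T j k * dmat ?D n j)"
      by (rule dmat_mult) (auto intro!: M)
    also have "\<dots> = (\<Sum>j<k + M + n + 1. if j = n - q then (if n \<ge> q then dmat T j k else 0) else 0)"
      by (intro sum.cong) (auto simp: D)
    finally show ?thesis by (simp del: sum.lessThan_Suc) linarith
  qed
  show ?thesis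
  proof (cases "int m + (r + int q) \<ge> 0")
    case True
    define n where "n = nat (int m + (r + int q))"
    have n: "nat (int (m + q) + r) = n" "int (m + q) + r \<ge> 0" using True by (auto simp: n_def)
    have n': "n \<ge> q \<longleftrightarrow> int m + r \<ge> 0" if "q > 0" using True that unfolding n_def by linarith
    have n'': "nat (int m + r) = n - q" if "int m + r \<ge> 0" using that unfolding n_def by linarith
    have "diag (ad ?D T) (r + int q) m = dmat (?D * T) n m - dmat (T * ?D) n m"
      using True by (simp add: diag_def ad_def dmat_diff n_def)
    also have "dmat (?D * T) n m = diag T r (m + q)" using n by (simp add: 1 diag_def)
    also have "dmat (T * ?D) n m = diag T r m"
      using n' n'' True by (cases "q = 0") (auto simp: 2 diag_def)
    finally show ?thesis by (simp add: fdiff_def)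
  qed (auto simp: diag_def fdiff_def)
qed

lemma diag_ad_diff_power_pow:
  "diag ((ad (dsym_diff ^ q) ^^ l) T) (r + int (l * q)) m = (fdiff q ^^ l) (diag T r) m"
proof (induction l arbitrary: m)
  case (Suc l)
  have "r + int (Suc l * q) = (r + int (l * q)) + int q" by simp
  then have "diag ((ad (dsym_diff ^ q) ^^ Suc l) T) (r + int (Suc l * q)) m
     = fdiff q (diag ((ad (dsym_diff ^ q) ^^ l) T) (r + int (l * q))) m"
    by (simp only: funpow.simps comp_apply diag_ad_diff_power)
  also have "diag ((ad (dsym_diff ^ q) ^^ l) T) (r + int (l * q)) = (fdiff q ^^ l) (diag T r)"
    using Suc by blast
  finally show ?case by simp
qed simp

section \<open>Symbols\<close>

text \<open>
  With \<open>\<tau> = \<sigma> / \<rho>\<close>, the component of order \<open>r\<close> of \<open>T\<close> has degree at most \<open>(w - r) / \<tau>\<close> in \<open>m\<close>,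
  that is, \<open>T\<close> has \<open>(\<sigma>, \<rho>)\<close>-weight at most \<open>\<rho> w\<close>.  The coefficients on the line of weight
  \<open>\<rho> w\<close> are required to be constants and are collected in the power series \<open>\<phi>\<close>, with the one of order
  \<open>w - n\<close> at the exponent \<open>n\<close>.
\<close>

definition has_symbol :: "nat \<Rightarrow> real \<Rightarrow> nat \<Rightarrow> 'a::field_char_0 fps \<Rightarrow> 'a dsym \<Rightarrow> bool" where
  "has_symbol q \<tau> w \<phi> T \<longleftrightarrow> (\<forall>r. qpoly q ((real w - real_of_int r) / \<tau>)
     (if r \<le> int w then \<phi> $ nat (int w - r) else 0) (diag T r))"

lemma diag_add: "diag (T + U) r m = diag T r m + diag U r m"
  by (simp add: diag_def dmat_add)

lemma diag_0: "diag 0 r m = 0"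
  by (simp add: diag_def dmat_0)

lemma has_symbol_0: "has_symbol q \<tau> w 0 0"
  unfolding has_symbol_def by (auto simp: diag_0[abs_def] intro: qpoly_0)

lemma has_symbol_add:
  assumes "has_symbol q \<tau> w \<phi> T" "has_symbol q \<tau> w \<psi> U"
  shows "has_symbol q \<tau> w (\<phi> + \<psi>) (T + U)"
  unfolding has_symbol_def
proof
  fix r
  from qpoly_add[OF assms(1)[unfolded has_symbol_def, rule_format, of r]
      assms(2)[unfolded has_symbol_def, rule_format, of r]]
  show "qpoly q ((real w - real_of_int r) / \<tau>)
     (if r \<le> int w then (\<phi> + \<psi>) $ nat (int w - r) else 0) (diag (T + U) r)"
    by (cases "r \<le> int w") (simp_all add: diag_add[abs_def])
qed

lemma has_symbol_sum:
  "(\<And>i. i \<in> I \<Longrightarrow> has_symbol q \<tau> w (\<phi> i) (T i)) \<Longrightarrow> has_symbol q \<tau> w (\<Sum>i\<in>I. \<phi> i) (\<Sum>i\<in>I. T i)"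
  by (induction I rule: infinite_finite_induct) (auto intro: has_symbol_0 has_symbol_add)

lemma has_symbol_less:
  assumes "has_symbol q \<tau> w \<phi> T" "w < v" "\<tau> > 0"
  shows "has_symbol q \<tau> v 0 T"
  unfolding has_symbol_def
proof
  fix r
  have "(real w - real_of_int r) / \<tau> < (real v - real_of_int r) / \<tau>"
    using assms(2,3) by (simp add: divide_strict_right_mono)
  from qpoly_less[OF assms(1)[unfolded has_symbol_def, rule_format, of r] this]
  show "qpoly q ((real v - real_of_int r) / \<tau>) (if r \<le> int v then 0 $ nat (int v - r) else 0) (diag T r)"
    by simp
qed

lemma has_symbol_0_unique:
  assumes "has_symbol q \<tau> w \<phi> 0"
  shows "\<phi> = 0"
proof (rule fps_ext)
  fix n
  have "qpoly q ((real w - real_of_int (int w - int n)) / \<tau>) (\<phi> $ n) (diag 0 (int w - int n))"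
    using assms[unfolded has_symbol_def, rule_format, of "int w - int n"] by simp
  then show "\<phi> $ n = 0 $ n"
    unfolding diag_0[abs_def] fps_zero_nth by (rule qpoly_0_unique)
qed

lemma has_symbol_homog:
  assumes "homog (int w) (\<lambda>_. c) T" "\<tau> > 0"
  shows "has_symbol q \<tau> w (fps_const c) T"
  unfolding has_symbol_def
proof
  fix r
  have d: "diag T r = (\<lambda>m. if r = int w then c else 0)"
    by (rule ext) (auto simp: diag_def homogD[OF assms(1)])
  show "qpoly q ((real w - real_of_int r) / \<tau>)
     (if r \<le> int w then fps_const c $ nat (int w - r) else 0) (diag T r)"
  proof (cases "r = int w")
    case True
    have "(fdiff q ^^ k) (\<lambda>m. c) m = (if real k = 0 then fact k * c else 0)" for k m
    proof (cases k)
      case (Suc j)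
      have "(fdiff q ^^ k) (\<lambda>m. c) m = 0"
        by (rule fdiff_pow_mono[of 1]) (auto simp: fdiff_def Suc)
      then show ?thesis using Suc by simp
    qed simp
    then show ?thesis unfolding d qpoly_def using True by simp
  next
    case False
    then have "(if r \<le> int w then fps_const c $ nat (int w - r) else 0) = 0" by simp
    then show ?thesis using False by (simp add: d qpoly_0)
  qed
qed

lemma upper_exists: "\<exists>M. a \<le> M \<and> upper M T"
proof -
  obtain M where M: "\<And>n k. n > k + M \<Longrightarrow> dmat T n k = 0" using dmat_bounded by blast
  have "upper (max a (int M)) T" unfolding upper_def by (auto intro!: M)
  then show ?thesis by (intro exI[of _ "max a (int M)"]) auto
qed

text \<open>
  For rows \<open>m\<close> far enough from the corner of the matrix the entries of the product are given by a sum
  over a range that does not depend on \<open>m\<close>.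
\<close>

lemma diag_mult:
  assumes T: "upper M T" and U: "upper N U" and m: "int m + r \<ge> 0" "int m + (r - N) \<ge> 0" "int m + M \<ge> 0"
  shows "diag (T * U) r m = (\<Sum>a\<in>{r - N..M}. diag T a m * diag U (r - a) (nat (int m + a)))"
proof -
  define n where "n = nat (int m + r)"
  define B where "B = nat (int m + M) + 1"
  define g where "g j = dmat T j m * dmat U n j" for j
  have T0: "dmat T j m = 0" if "int j - int m > M" for j using T that by (simp add: upper_def)
  have U0: "dmat U n j = 0" if "int n - int j > N" for j using U that by (simp add: upper_def)
  have "diag (T * U) r m = (\<Sum>j<B. g j)"
    using m unfolding diag_def n_def[symmetric] g_def B_def
    by (simp del: sum.lessThan_Suc, intro dmat_mult T0) linarith
  also have "\<dots> = (\<Sum>j\<in>(\<lambda>a. nat (int m + a)) ` {r - N..M}. g j)"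
  proof (rule sum.mono_neutral_right)
    show "(\<lambda>a. nat (int m + a)) ` {r - N..M} \<subseteq> {..<B}" by (auto simp: B_def)
    show "\<forall>j\<in>{..<B} - (\<lambda>a. nat (int m + a)) ` {r - N..M}. g j = 0"
    proof
      fix j assume j: "j \<in> {..<B} - (\<lambda>a. nat (int m + a)) ` {r - N..M}"
      have "int j - int m \<notin> {r - N..M}"
      proof
        assume "int j - int m \<in> {r - N..M}"
        then have "nat (int m + (int j - int m)) \<in> (\<lambda>a. nat (int m + a)) ` {r - N..M}" by blast
        then show False using j by simp
      qed
      then have "int j - int m > M \<or> int n - int j > N" using m by (auto simp: n_def)
      then show "g j = 0" using T0 U0 by (auto simp: g_def)
    qed
  qed simp
  also have "\<dots> = (\<Sum>a\<in>{r - N..M}. g (nat (int m + a)))"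
    using m by (subst sum.reindex) (auto simp: inj_on_def)
  also have "\<dots> = (\<Sum>a\<in>{r - N..M}. diag T a m * diag U (r - a) (nat (int m + a)))"
  proof (intro sum.cong refl)
    fix a assume "a \<in> {r - N..M}"
    then have "int m + a \<ge> 0" using m by auto
    then show "g (nat (int m + a)) = diag T a m * diag U (r - a) (nat (int m + a))"
      using m by (simp add: g_def diag_def n_def)
  qed
  finally show ?thesis .
qed

text \<open>
  Symbols multiply like power series: on the diagonal \<open>r\<close> of the product, the diagonals \<open>a\<close> and
  \<open>r - a\<close> of the factors contribute the product of their top coefficients.  The second factor is
  evaluated at the row \<open>m + a\<close> instead of \<open>m\<close>; this shift leaves constant top coefficients unchanged,
  whereas for periodic ones it would make the multiplication of symbols noncommutative.
\<close>

lemma has_symbol_mult: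
  assumes T: "has_symbol q \<tau> w \<phi> T" and U: "has_symbol q \<tau> v \<psi> U"
  shows "has_symbol q \<tau> (w + v) (\<phi> * \<psi>) (T * U)"
  unfolding has_symbol_def
proof
  fix r
  obtain M where M: "int w \<le> M" "upper M T" using upper_exists by blast
  obtain N where N: "int v \<le> N" "upper N U" using upper_exists by blast
  define c where "c a = (if a \<le> int w then \<phi> $ nat (int w - a) else 0)" for a
  define d where "d a = (if a \<le> int v then \<psi> $ nat (int v - a) else 0)" for a
  define \<delta> where "\<delta> = (real (w + v) - real_of_int r) / \<tau>"
  have "qpoly q \<delta> (c a * d (r - a)) (\<lambda>m. diag T a m * diag U (r - a) (nat (int m + a)))" for a
  proof -
    have "\<delta> = (real w - real_of_int a) / \<tau> + (real v - real_of_int (r - a)) / \<tau>"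
      unfolding \<delta>_def by (simp add: algebra_simps flip: add_divide_distrib diff_divide_distrib)
    then show ?thesis
      using qpoly_mult[OF T[unfolded has_symbol_def, rule_format, of a]
          qpoly_int_shift[OF U[unfolded has_symbol_def, rule_format, of "r - a"], of a]]
      by (simp add: c_def d_def)
  qed
  then have "qpoly q \<delta> (\<Sum>a\<in>{r - N..M}. c a * d (r - a))
      (\<lambda>m. \<Sum>a\<in>{r - N..M}. diag T a m * diag U (r - a) (nat (int m + a)))"
    by (intro qpoly_sum)
  moreover have "\<forall>\<^sub>F m in sequentially.
      (\<Sum>a\<in>{r - N..M}. diag T a m * diag U (r - a) (nat (int m + a))) = diag (T * U) r m"
    using eventually_ge_at_top[of "nat (\<bar>r\<bar> + \<bar>N\<bar>)"]
  proof eventually_elim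
    case (elim m)
    show ?case by (rule diag_mult[OF M(2) N(2), symmetric]) (use elim M N in linarith)+
  qed
  ultimately have "qpoly q \<delta> (\<Sum>a\<in>{r - N..M}. c a * d (r - a)) (diag (T * U) r)"
    by (rule qpoly_cong)
  moreover have "(\<Sum>a\<in>{r - N..M}. c a * d (r - a))
      = (if r \<le> int (w + v) then (\<phi> * \<psi>) $ nat (int (w + v) - r) else 0)"
  proof -
    have "(\<Sum>a\<in>{r - N..M}. c a * d (r - a)) = (\<Sum>a\<in>{r - int v..int w}. c a * d (r - a))"
      using M N by (intro sum.mono_neutral_right) (auto simp: c_def d_def)
    also have "\<dots> = (if r \<le> int (w + v) then (\<phi> * \<psi>) $ nat (int (w + v) - r) else 0)"
    proof (cases "r \<le> int (w + v)")
      case True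
      define n where "n = nat (int (w + v) - r)"
      have "(\<Sum>a\<in>{r - int v..int w}. c a * d (r - a)) = (\<Sum>i=0..n. \<phi> $ i * \<psi> $ (n - i))"
      proof (rule sum.reindex_bij_witness[of _ "\<lambda>i. int w - int i" "\<lambda>a. nat (int w - a)"])
        fix a assume a: "a \<in> {r - int v..int w}"
        have "nat (int v - (r - a)) = n - nat (int w - a)" using a True unfolding n_def by auto
        then show "\<phi> $ nat (int w - a) * \<psi> $ (n - nat (int w - a)) = c a * d (r - a)"
          using a by (auto simp: c_def d_def)
      qed (use True in \<open>auto simp: n_def\<close>)
      then show ?thesis using True by (simp add: fps_mult_nth n_def)
    qed auto
    finally show ?thesis .
  qed
  ultimately show "qpoly q ((real (w + v) - real_of_int r) / \<tau>)
     (if r \<le> int (w + v) then (\<phi> * \<psi>) $ nat (int (w + v) - r) else 0) (diag (T * U) r)"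
    by (simp only: \<delta>_def)
qed

lemma has_symbol_power:
  assumes "has_symbol q \<tau> w \<phi> T" "\<tau> > 0"
  shows "has_symbol q \<tau> (n * w) (\<phi> ^ n) (T ^ n)"
proof (induction n)
  case 0
  have "homog (int 0) (\<lambda>_. 1) (1 :: 'a dsym)" using homog_1 by simp
  from has_symbol_homog[OF this assms(2)] show ?case by simp
next
  case (Suc n)
  from has_symbol_mult[OF assms(1) this] show ?case by simp
qed

text \<open>
  A root of a nonzero polynomial \<open>g\<close> over the field must have a constant term \<open>c\<close> with \<open>g(c) = 0\<close>;
  dividing \<open>g\<close> by \<open>X - c\<close> gives a polynomial of smaller degree with the same root, because
  \<open>\<phi> - c\<close> is not a zero divisor.
\<close>

lemma nonconstant_fps_transcendental:
  fixes \<phi> :: "'a::field fps"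
  assumes nc: "\<phi> \<noteq> fps_const (\<phi> $ 0)" and "(\<Sum>i\<le>n. fps_const (a i) * \<phi> ^ i) = 0"
  shows "i \<le> n \<Longrightarrow> a i = 0"
proof -
  define ev where "ev g = poly (map_poly fps_const g) \<phi>" for g
  have ev_pCons: "ev (pCons c g) = fps_const c + \<phi> * ev g" for c g
    by (simp add: ev_def map_poly_pCons)
  have ev0: "ev g $ 0 = poly g (\<phi> $ 0)" for g
    by (induction g) (auto simp: ev_pCons, simp add: ev_def)
  have ev_factor: "ev ([:- c, 1:] * g) = (\<phi> - fps_const c) * ev g" for c g
  proof -
    have add: "ev (g + h) = ev g + ev h" for g h
    proof -
      have "map_poly fps_const (g + h) = map_poly fps_const g + map_poly fps_const h"
        by (intro poly_eqI) (simp add: coeff_map_poly)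
      then show ?thesis by (simp add: ev_def)
    qed
    have smult: "ev (smult c g) = fps_const c * ev g" for c g
    proof -
      have "map_poly fps_const (smult c g) = smult (fps_const c) (map_poly fps_const g)"
        by (intro poly_eqI) (simp add: coeff_map_poly)
      then show ?thesis by (simp add: ev_def)
    qed
    have "[:- c, 1:] * g = smult (- c) g + pCons 0 g" by simp
    then show ?thesis by (simp only: add smult ev_pCons) (simp add: algebra_simps flip: fps_const_neg)
  qed
  have "ev g \<noteq> 0" if "g \<noteq> 0" for g
    using that
  proof (induction "degree g" arbitrary: g rule: less_induct)
    case less
    show ?case
    proof (cases "poly g (\<phi> $ 0) = 0")
      case True
      then obtain h where h: "g = [:- (\<phi> $ 0), 1:] * h" by (auto simp: poly_eq_0_iff_dvd elim: dvdE)
      then have "h \<noteq> 0" using less.prems by auto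
      moreover from this have "degree h < degree g" unfolding h by (subst degree_mult_eq) auto
      ultimately have "ev h \<noteq> 0" using less.hyps by blast
      then show ?thesis using nc unfolding h ev_factor by simp
    next
      case False
      then show ?thesis using ev0[of g] by auto
    qed
  qed
  moreover define g where "g = (\<Sum>i\<le>n. monom (a i) i)"
  have cg: "coeff g i = (if i \<le> n then a i else 0)" for i
    by (simp add: g_def coeff_sum)
  have "ev g = (\<Sum>i\<le>n. fps_const (a i) * \<phi> ^ i)"
  proof -
    have "degree (map_poly fps_const g) \<le> n"
      by (rule degree_le) (simp add: coeff_map_poly cg)
    then have "ev g = (\<Sum>i\<le>n. coeff (map_poly fps_const g) i * \<phi> ^ i)"
      unfolding ev_def poly_altdef by (intro sum.mono_neutral_left) (auto simp: coeff_eq_0)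
    then show ?thesis by (simp add: coeff_map_poly cg)
  qed
  ultimately have "g = 0" using assms(2) by auto
  then show "i \<le> n \<Longrightarrow> a i = 0" using cg[of i] by simp
qed

section \<open>Conjugation by a Schur operator\<close>

lemma schur_operator_upper:
  assumes "schur_operator Q q S"
  shows "upper 0 S" "diag S 0 m = 1"
proof -
  have "coeffs_ord (dsym_coeff S) \<le> ereal 0"
    using assms by (simp add: schur_operator_def dsym_ord_def zero_ereal_def)
  then have c: "s \<le> i" if "dsym_coeff S s $ i \<noteq> 0" for s i
    using that unfolding coeffs_ord_le_iff by fastforce
  show "upper 0 S" unfolding upper_def
  proof (intro allI impI)
    fix n k assume nk: "int n - int k > 0"
    have "dsym_coeff S (i + n - k) $ i = 0" for i using c[of "i + n - k" i] nk by fastforce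
    then show "dmat S n k = 0" unfolding dmat_def by (intro sum.neutral ballI) (simp only: mult_zero_left if_cancel)
  qed
  have "dsym_hcomp S 0 = 1" using assms by (simp add: schur_operator_def)
  then have "dmat (dsym_hcomp S 0) m m = 1" by (simp add: dmat_1)
  then show "diag S 0 m = 1" by (simp add: dmat_hcomp diag_def)
qed

lemma ODO_coeff_above_deg:
  assumes "P \<in> ODO" "s > dsym_deg P"
  shows "dsym_coeff P s = 0"
proof (rule ccontr)
  assume "dsym_coeff P s \<noteq> 0"
  then have "s \<le> Max {s. dsym_coeff P s \<noteq> 0}" using assms(1) by (intro Max_ge) (auto simp: ODO_def)
  then show False using assms(2) by (simp add: dsym_deg_def)
qed

lemma conjugate_mult:
  fixes S U :: "'a::ring_1"
  assumes "S * U = 1" shows "U * (A * B) * S = (U * A * S) * (U * B * S)"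
proof -
  have "(U * A * S) * (U * B * S) = U * A * (S * U) * B * S" by (simp only: mult.assoc)
  then show ?thesis by (simp add: assms mult.assoc)
qed

lemma conjugate_power:
  fixes S U :: "'a::ring_1"
  assumes "S * U = 1" "U * S = 1" shows "U * A ^ n * S = (U * A * S) ^ n"
  by (induction n) (simp_all add: assms conjugate_mult[OF assms(1)])

lemma conjugate_ad_pow:
  assumes "S * U = 1" shows "U * (ad Q ^^ l) P * S = (ad (U * Q * S) ^^ l) (U * P * S)"
proof (induction l)
  case (Suc l)
  have "U * ad Q T * S = ad (U * Q * S) (U * T * S)" for T
    unfolding ad_def by (simp add: right_diff_distrib left_diff_distrib conjugate_mult[OF assms])
  then show ?case using Suc by simp
qed simp

lemma conjugate_poly2_eval:
  assumes "S * U = 1" "U * S = 1"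
  shows "U * poly2_eval F P Q * S = poly2_eval F (U * P * S) (U * Q * S)"
proof -
  have c: "U * dsym_const c * S = dsym_const c" for c
    by (simp add: mult.assoc dsym_const_commute[of c S])
       (simp add: assms mult.assoc[symmetric])
  show ?thesis
    unfolding poly2_eval_def sum_distrib_left sum_distrib_right
      conjugate_mult[OF assms(1)] conjugate_power[OF assms] c ..
qed

context
  fixes P Q S :: "'a::field_char_0 dsym" and p q :: nat
  assumes P_above: "\<And>s. s > p \<Longrightarrow> dsym_coeff P s = 0" and P_lead: "dsym_coeff P p = 1"
    and Q_above: "\<And>s. s > q \<Longrightarrow> dsym_coeff Q s = 0" and q: "q > 0"
    and S: "schur_operator Q q S"
begin

abbreviation (input) "P' \<equiv> dsym_inv S * P * S"

lemma S_inv: "S * dsym_inv S = 1" "dsym_inv S * S = 1" "dsym_inv S * Q * S = dsym_diff ^ q"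
  using S dsym_inv[of S] by (auto simp: schur_operator_def)

lemmas S_upper = schur_operator_upper[OF S] and S_inv_upper = upper_inverse[OF schur_operator_upper[OF S] S_inv(1)]

lemma conjugate_ad_pow_diff:
  "dsym_inv S * (ad Q ^^ l) P * S = (ad (dsym_diff ^ q) ^^ l) P'"
  using conjugate_ad_pow[OF S_inv(1), of l Q P] by (simp only: S_inv(3))

lemma ad_pow_above: "s > p + l * (q - 1) \<Longrightarrow> dsym_coeff ((ad Q ^^ l) P) s = 0"
  by (rule coeff_ad_pow[OF P_above Q_above q])

text \<open>
  \<open>ad_Q^l P\<close> has degree, hence order, at most \<open>p + l (q - 1)\<close>, and so has its conjugate
  \<open>ad_(\<partial>^q)^l P'\<close>.  As the component of order \<open>r\<close> of \<open>P'\<close> moves to order \<open>r + l q\<close> there, its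
  \<open>l\<close>-th difference vanishes once \<open>r + l q > p + l (q - 1)\<close>.  This is the reason why all components
  of \<open>P'\<close> are HCPs.
\<close>

lemma fdiff_diag_conjugate_eq_0:
  assumes "r > int p - int l"
  shows "(fdiff q ^^ l) (diag P' r) m = 0"
proof -
  have "upper (int (p + l * (q - 1))) ((ad Q ^^ l) P)"
    unfolding upper_diag by (intro allI impI diag_eq_0_of_coeff[OF ad_pow_above])
  from upper_conjugate(1)[OF S_inv_upper S_upper this]
  have *: "upper (int (p + l * (q - 1))) ((ad (dsym_diff ^ q) ^^ l) P')"
    unfolding conjugate_ad_pow_diff .
  have "int (l * q) = int (l * (q - 1)) + int l"
    using q by (cases q) auto
  then have "r + int (l * q) > int (p + l * (q - 1))" using assms by simp
  with * show ?thesis unfolding upper_diag diag_ad_diff_power_pow[symmetric] by blast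
qed

text \<open>
  The decisive step.  The first hypothesis says that the component of order \<open>r + l q\<close> of
  \<open>ad_(\<partial>^q)^l P'\<close>, which is the \<open>l\<close>-th difference in question, is the highest one.  Conjugating back
  preserves it, so it is the highest component of \<open>ad_Q^l P\<close> as well, and therefore a polynomial in
  \<open>m\<close>.  The second hypothesis says that it is \<open>q\<close>-periodic.  Both together make it constant, so that
  none of the \<open>A_i\<close> with \<open>0 < i\<close> occurs on the top line.
\<close>

lemma fdiff_diag_conjugate_constant:
  assumes above: "\<And>r' m. r' > r \<Longrightarrow> (fdiff q ^^ l) (diag P' r') m = 0"
    and top: "\<And>m. (fdiff q ^^ Suc l) (diag P' r) m = 0"
  shows "(fdiff q ^^ l) (diag P' r) m = (fdiff q ^^ l) (diag P' r) 0"
proof -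
  let ?T = "(ad Q ^^ l) P" and ?T' = "(ad (dsym_diff ^ q) ^^ l) P'"
  let ?r = "r + int (l * q)"
  have u: "upper ?r ?T'"
    unfolding upper_diag
  proof (intro allI impI)
    fix s m assume "s > ?r"
    then have "(fdiff q ^^ l) (diag P' (s - int (l * q))) m = 0" by (intro above) simp
    then show "diag ?T' s m = 0" using diag_ad_diff_power_pow[where q = q and l = l and r = "s - int (l * q)" and m = m and T = P']
      by simp
  qed
  have "S * ?T' * dsym_inv S = (S * dsym_inv S) * ?T * (S * dsym_inv S)"
    unfolding conjugate_ad_pow_diff[symmetric] by (simp only: mult.assoc)
  then have "S * ?T' * dsym_inv S = ?T" by (simp add: S_inv)
  with upper_conjugate(2)[OF S_upper S_inv_upper u] have "diag ?T ?r m = diag ?T' ?r m" for m by simp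
  then have e: "(fdiff q ^^ l) (diag P' r) m = diag ?T ?r m" for m
    by (simp only: diag_ad_diff_power_pow)
  obtain R where R: "\<And>m. diag ?T ?r m = poly R (of_nat m)"
    using diag_polynomial[OF ad_pow_above] by blast
  have "poly R (of_nat (m + q)) = poly R (of_nat m)" for m
    using top[of m] unfolding fdiff_pow_Suc e R by simp
  from periodic_polynomial_constant[OF this q] show ?thesis
    unfolding e R by (metis of_nat_0)
qed

lemma diag_conjugate_top: "diag P' (int p) m = 1"
proof -
  have "upper (int p) P"
    unfolding upper_diag by (intro allI impI diag_eq_0_of_coeff[OF P_above])
  then have "diag P' (int p) m = diag P (int p) m"
    by (rule upper_conjugate(2)[OF S_inv_upper S_upper])
  also have "\<dots> = 1" using diag_coeff[OF P_above, where r = "int p" and N = 0 and m = m] P_lead by simp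
  finally show ?thesis .
qed

text \<open>
  Along the top line both hypotheses of \<open>fdiff_diag_conjugate_constant\<close> hold: orders above \<open>r\<close> have smaller
  degrees than \<open>(p - r) / \<tau>\<close>, and this degree is not exceeded at \<open>r\<close>.
\<close>

lemma conjugate_has_symbol:
  assumes \<tau>: "\<tau> > 0"
    and vanish: "\<And>r k m. (real p - real_of_int r) / \<tau> < real k \<Longrightarrow> (fdiff q ^^ k) (diag P' r) m = 0"
  shows "\<exists>\<phi>. has_symbol q \<tau> p \<phi> P' \<and>
    (\<forall>l n. real n = real l * \<tau> \<longrightarrow> \<phi> $ n = (fdiff q ^^ l) (diag P' (int p - int n)) 0 / fact l)"
proof -
  define \<phi> where "\<phi> = Abs_fps (\<lambda>n. if real n / \<tau> \<in> \<nat>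
      then (fdiff q ^^ nat \<lfloor>real n / \<tau>\<rfloor>) (diag P' (int p - int n)) 0 / fact (nat \<lfloor>real n / \<tau>\<rfloor>) else 0)"
  have \<phi>: "\<phi> $ n = (fdiff q ^^ l) (diag P' (int p - int n)) 0 / fact l" if "real n = real l * \<tau>" for l n
  proof -
    have "real n / \<tau> = real l" using that \<tau> by simp
    then show ?thesis by (simp add: \<phi>_def)
  qed
  have "has_symbol q \<tau> p \<phi> P'"
    unfolding has_symbol_def
  proof
    fix r
    define \<delta> where "\<delta> = (real p - real_of_int r) / \<tau>"
    define c where "c = (if r \<le> int p then \<phi> $ nat (int p - r) else 0)"
    have "qpoly q \<delta> c (diag P' r)"
    proof (cases "\<delta> \<in> \<nat>")
      case True
      then obtain l where l: "\<delta> = real l" by (auto elim: Nats_cases)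
      define n where "n = nat (int p - r)"
      have "0 \<le> \<delta>" using l by simp
      then have "r \<le> int p" using \<tau> by (simp add: \<delta>_def zero_le_divide_iff)
      then have n: "int p - int n = r" "real n = real p - real_of_int r" by (auto simp: n_def)
      have "c = (fdiff q ^^ l) (diag P' r) 0 / fact l"
        using \<phi>[of n l] n \<open>r \<le> int p\<close> l \<tau> by (simp add: c_def \<delta>_def n_def field_simps)
      moreover have "(fdiff q ^^ l) (diag P' r) m = (fdiff q ^^ l) (diag P' r) 0" for m
      proof (rule fdiff_diag_conjugate_constant)
        fix r' m assume "r' > r"
        then have "(real p - real_of_int r') / \<tau> < \<delta>"
          unfolding \<delta>_def using \<tau> by (intro divide_strict_right_mono) auto
        then show "(fdiff q ^^ l) (diag P' r') m = 0" unfolding l by (rule vanish)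
      next
        fix m show "(fdiff q ^^ Suc l) (diag P' r) m = 0"
          by (rule vanish) (use l in \<open>simp add: \<delta>_def\<close>)
      qed
      ultimately have "(fdiff q ^^ l) (diag P' r) m = fact l * c" for m by simp
      then show ?thesis unfolding qpoly_def using vanish[of r, folded \<delta>_def] True l by auto
    next
      case False
      then have "(fdiff q ^^ k) (diag P' r) m = 0" if "\<delta> \<le> real k" for k m
        using that vanish[of r k m, folded \<delta>_def] by (cases "\<delta> = real k") auto
      moreover have "c = 0"
      proof (cases "r \<le> int p")
        case True
        then have "real (nat (int p - r)) / \<tau> = \<delta>" by (simp add: \<delta>_def)
        then show ?thesis using False True by (simp add: c_def \<phi>_def \<delta>_def)
      qed (simp add: c_def)
      ultimately show ?thesis unfolding qpoly_def by simp
    qed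
    then show "qpoly q ((real p - real_of_int r) / \<tau>)
      (if r \<le> int p then \<phi> $ nat (int p - r) else 0) (diag P' r)" by (simp only: \<delta>_def c_def)
  qed
  then show ?thesis using \<phi> by blast
qed

end

text \<open>
  The symbol of \<open>\<partial>^q\<close> is \<open>1\<close>.  The terms \<open>X^i Y^j\<close> of \<open>F\<close> with the largest \<open>i p + j q\<close> contribute
  \<open>c i j * \<phi>^i\<close> to the symbol of \<open>F(T, \<partial>^q)\<close>, all others contribute \<open>0\<close>.  Since \<open>q > 0\<close>, the exponent
  \<open>i\<close> determines \<open>j\<close>, so no two of these terms cancel formally and the symbol is a nonzero polynomial in
  the transcendental series \<open>\<phi>\<close>.
\<close>

lemma poly2_eval_neq_0_of_symbol:
  fixes T :: "'a::field_char_0 dsym"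
  assumes T: "has_symbol q \<tau> p \<phi> T" and nc: "\<phi> \<noteq> fps_const (\<phi> $ 0)" and "\<tau> > 0" "q > 0" "F \<noteq> 0"
  shows "poly2_eval F T (dsym_diff ^ q) \<noteq> 0"
proof
  assume zero: "poly2_eval F T (dsym_diff ^ q) = 0"
  define c where "c i j = coeff (coeff F i) j" for i j
  define W where "W = {(i, j). i \<le> degree F \<and> j \<le> degree (coeff F i) \<and> c i j \<noteq> 0}"
  have "W \<subseteq> (SIGMA i:{..degree F}. {..degree (coeff F i)})" by (auto simp: W_def)
  then have "finite W" by (rule finite_subset) simp
  moreover have "(degree F, degree (coeff F (degree F))) \<in> W" using \<open>F \<noteq> 0\<close> by (simp add: W_def c_def)
  ultimately have W: "finite W" "W \<noteq> {}" by auto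
  define wt where "wt = (\<lambda>(i, j). i * p + j * q)"
  define N where "N = Max (wt ` W)"
  have N: "wt e \<le> N" if "e \<in> W" for e using W that by (simp add: N_def)
  define \<chi> where "\<chi> i j = (if i * p + j * q = N then fps_const (c i j) * \<phi> ^ i else 0)" for i j
  have "has_symbol q \<tau> N (\<chi> i j) (dsym_const (c i j) * T ^ i * (dsym_diff ^ q) ^ j)"
    if "i \<le> degree F" "j \<le> degree (coeff F i)" for i j
  proof (cases "c i j = 0")
    case True
    have "dsym_const 0 * (U :: 'a dsym) = 0" for U by (rule dmat_eqI) (simp add: dmat_const_mult dmat_0)
    then show ?thesis using True has_symbol_0 by (simp add: \<chi>_def)
  next
    case False
    have "homog (int 0) (\<lambda>_. c i j) (dsym_const (c i j))"
      using homog_const_mult[OF homog_1, of "c i j"] by simp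
    note 1 = has_symbol_homog[OF this \<open>\<tau> > 0\<close>, where q = q]
    note 2 = has_symbol_power[OF T \<open>\<tau> > 0\<close>, of i]
    note 3 = has_symbol_power[OF has_symbol_homog[OF homog_diff_power[of q] \<open>\<tau> > 0\<close>] \<open>\<tau> > 0\<close>,
        where q = q and n = j]
    have 4: "has_symbol q \<tau> (i * p + j * q) (fps_const (c i j) * \<phi> ^ i)
        (dsym_const (c i j) * T ^ i * (dsym_diff ^ q) ^ j)"
      using has_symbol_mult[OF has_symbol_mult[OF 1 2] 3] by simp
    have "i * p + j * q \<le> N" using N[of "(i, j)"] that False by (simp add: W_def wt_def)
    then show ?thesis
      using 4 has_symbol_less[OF 4 _ \<open>\<tau> > 0\<close>, of N] by (cases "i * p + j * q = N") (auto simp: \<chi>_def)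
  qed
  then have "has_symbol q \<tau> N (\<Sum>i\<le>degree F. \<Sum>j\<le>degree (coeff F i). \<chi> i j) (poly2_eval F T (dsym_diff ^ q))"
    unfolding poly2_eval_def c_def by (intro has_symbol_sum) auto
  then have sum0: "(\<Sum>i\<le>degree F. \<Sum>j\<le>degree (coeff F i). \<chi> i j) = 0"
    unfolding zero by (rule has_symbol_0_unique)
  define a where "a i = (\<Sum>j\<le>degree (coeff F i). if i * p + j * q = N then c i j else 0)" for i
  have "(\<Sum>j\<le>degree (coeff F i). \<chi> i j) = fps_const (a i) * \<phi> ^ i" for i
  proof -
    have "fps_const (\<Sum>j\<in>J. f j) = (\<Sum>j\<in>J. fps_const (f j))" for f :: "nat \<Rightarrow> 'a" and J
      by (rule fps_ext) (simp add: fps_sum_nth)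
    then show ?thesis
      unfolding a_def by (simp add: sum_distrib_right) (intro sum.cong, auto simp: \<chi>_def)
  qed
  with sum0 have a0: "a i = 0" if "i \<le> degree F" for i
    using nonconstant_fps_transcendental[OF nc, where n = "degree F" and a = a] that by simp
  have "N \<in> wt ` W" unfolding N_def using W by (intro Max_in) auto
  then obtain i j where ij: "(i, j) \<in> W" "i * p + j * q = N" by (auto simp: wt_def)
  have "a i = (\<Sum>l\<le>degree (coeff F i). if l = j then c i l else 0)"
    unfolding a_def using ij(2) \<open>q > 0\<close> by (intro sum.cong) auto
  also have "\<dots> = c i j" using ij(1) by (auto simp: W_def)
  finally show False using a0[of i] ij(1) by (auto simp: W_def)
qed

section \<open>The theorem\<close>

theorem theorem2p1:
  fixes P Q S :: "'a::field_char_0 dsym" and p q :: nat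
    and \<iota> :: "'a \<Rightarrow> 'b::field_char_0" and \<xi> :: 'b
  assumes "P \<in> ODO" and "Q \<in> ODO"
    and "dsym_monic P" and "dsym_ord P = ereal (real p)" and "dsym_deg P = p"
    and "dsym_normalized Q" and "dsym_ord Q = ereal (real q)" and "dsym_deg Q = q" and "q > 0"
    and "schur_operator Q q S"
    and "field_embedding \<iota>" and "primitive_root_of_unity q \<xi>"
    and "restriction_top_line p (dsym_E \<iota> q \<xi> (dsym_map \<iota> (dsym_inv S * P * S)))"
  shows "\<not> (\<exists>F :: 'a poly poly. F \<noteq> 0 \<and> poly2_eval F P Q = 0)"
proof -
  let ?P' = "dsym_inv S * P * S"
  let ?E = "dsym_E \<iota> q \<xi> (dsym_map \<iota> ?P')"
  note emb = \<open>field_embedding \<iota>\<close> and prim = \<open>primitive_root_of_unity q \<xi>\<close>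
  have P_above: "dsym_coeff P s = 0" if "s > p" for s
    using ODO_coeff_above_deg[of P s] assms(1,5) that by simp
  have Q_above: "dsym_coeff Q s = 0" if "s > q" for s
    using ODO_coeff_above_deg[of Q s] assms(2,8) that by simp
  have P_lead: "dsym_coeff P p = 1" using assms(3,5) by (simp add: dsym_monic_def)
  note ctx = P_above P_lead Q_above \<open>q > 0\<close> \<open>schur_operator Q q S\<close>
  have top: "diag ?P' (int p) m = 1" for m by (rule diag_conjugate_top[OF ctx])
  from assms(13) obtain \<sigma> \<rho> where sr: "\<sigma> \<ge> 0" "\<rho> > 0"
    and p_top: "(0, int p) \<in> top_line \<sigma> \<rho> ?E"
    and two: "\<exists>e\<in>?E. \<exists>e'\<in>?E. e \<noteq> e' \<and> e \<in> top_line \<sigma> \<rho> ?E \<and> e' \<in> top_line \<sigma> \<rho> ?E"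
    unfolding restriction_top_line_def by blast
  have sup: "weight_sup \<sigma> \<rho> ?E = ereal (\<rho> * real p)"
    using p_top by (simp add: top_line_def weight_def)
  have below: "\<sigma> * real l + \<rho> * real_of_int j \<le> \<rho> * real p" if "(l, j) \<in> ?E" for l j
  proof -
    have "ereal (weight \<sigma> \<rho> (l, j)) \<le> weight_sup \<sigma> \<rho> ?E"
      unfolding weight_sup_def by (rule SUP_upper[OF that])
    then show ?thesis unfolding sup by (simp add: weight_def)
  qed
  obtain e where e: "e \<in> ?E" "e \<noteq> (0, int p)" "e \<in> top_line \<sigma> \<rho> ?E" using two by metis
  obtain l j where lj: "e = (l, j)" by (cases e)
  have line: "\<sigma> * real l + \<rho> * real_of_int j = \<rho> * real p"
    using e(3) unfolding top_line_def mem_Collect_eq sup lj by (simp add: weight_def)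
  \<comment> \<open>As \<open>\<rho> > 0\<close>, the line meets the axis \<open>l = 0\<close> only in \<open>(0, p)\<close>.\<close>
  have "l \<noteq> 0"
  proof
    assume "l = 0"
    then have "real_of_int j = real p" using line sr by simp
    then have "j = int p" by linarith
    then show False using e(2) lj \<open>l = 0\<close> by simp
  qed
  obtain k m where k: "k \<ge> l" "(fdiff q ^^ k) (diag ?P' j) m \<noteq> 0"
    using point_imp_fdiff_diag_neq_0[OF emb prim e(1)[unfolded lj]] by blast
  \<comment> \<open>For \<open>\<sigma> = 0\<close> the second point would have order \<open>p\<close>, but that component of \<open>P'\<close> is \<open>\<partial>^p\<close>.\<close>
  have "\<sigma> \<noteq> 0"
  proof
    assume "\<sigma> = 0"
    then have "real_of_int j = real p" using line sr by simp
    then have "j = int p" by linarith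
    then have "(fdiff q ^^ 1) (diag ?P' j) m = 0" for m by (simp add: fdiff_def top)
    from fdiff_pow_mono[OF this] k \<open>l \<noteq> 0\<close> show False by auto
  qed
  define \<tau> where "\<tau> = \<sigma> / \<rho>"
  have \<tau>: "\<tau> > 0" "\<sigma> = \<tau> * \<rho>" using sr \<open>\<sigma> \<noteq> 0\<close> by (auto simp: \<tau>_def)
  have vanish: "(fdiff q ^^ k) (diag ?P' r) m = 0" if "(real p - real_of_int r) / \<tau> < real k" for r k m
  proof (rule fdiff_diag_eq_0_of_points[OF emb prim])
    \<comment> \<open>Some difference vanishes, which makes the component an HCP; its points then give the sharp bound.\<close>
    show "(fdiff q ^^ (nat (int p - r) + 1)) (diag ?P' r) m = 0" for m
    proof (rule fdiff_diag_conjugate_eq_0[OF ctx])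
      have "int (nat (int p - r)) \<ge> int p - r" by simp
      then show "int p - int (nat (int p - r) + 1) < r" by simp
    qed
    fix l assume "(l, r) \<in> ?E"
    from below[OF this] have "\<rho> * (\<tau> * real l) \<le> \<rho> * (real p - real_of_int r)"
      by (simp add: \<tau>(2) algebra_simps)
    then have "\<tau> * real l \<le> real p - real_of_int r" using sr(2) by simp
    also have "\<dots> < \<tau> * real k" using that \<tau>(1) by (simp add: field_simps)
    finally show "l < k" using \<tau>(1) by simp
  qed
  obtain \<phi> where \<phi>: "has_symbol q \<tau> p \<phi> ?P'"
    "\<And>l n. real n = real l * \<tau> \<Longrightarrow> \<phi> $ n = (fdiff q ^^ l) (diag ?P' (int p - int n)) 0 / fact l"
    using conjugate_has_symbol[OF ctx \<tau>(1) vanish] by blast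
  have jl: "real p - real_of_int j = real l * \<tau>"
  proof -
    have "\<rho> * (real p - real_of_int j) = \<rho> * (real l * \<tau>)" using line \<tau>(2) by (simp add: algebra_simps)
    then show ?thesis using sr(2) by simp
  qed
  \<comment> \<open>The difference that detects the second point is the one of the top degree, so it enters the symbol.\<close>
  have "k = l"
  proof (rule ccontr)
    assume "k \<noteq> l"
    then have "(real p - real_of_int j) / \<tau> < real k" using jl k(1) \<tau>(1) by simp
    from vanish[OF this] k(2) show False by simp
  qed
  have "(fdiff q ^^ l) (diag ?P' j) m = (fdiff q ^^ l) (diag ?P' j) 0"
  proof (rule fdiff_diag_conjugate_constant[OF ctx])
    show "(fdiff q ^^ l) (diag ?P' r') m = 0" if "r' > j" for r' m
      by (rule vanish) (use that jl \<tau>(1) in \<open>simp add: field_simps\<close>)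
    show "(fdiff q ^^ Suc l) (diag ?P' j) m = 0" for m
      by (rule vanish) (use jl \<tau>(1) in \<open>simp add: field_simps\<close>)
  qed
  then have nz: "(fdiff q ^^ l) (diag ?P' j) 0 \<noteq> 0" using k(2) \<open>k = l\<close> by simp
  define n where "n = nat (int p - j)"
  have "real l * \<tau> > 0" using \<open>l \<noteq> 0\<close> \<tau>(1) by simp
  then have "real_of_int j < real p" using jl by simp
  then have "j < int p" by linarith
  then have n: "int p - int n = j" "n > 0" "real n = real l * \<tau>" using jl by (auto simp: n_def)
  have "\<phi> $ n \<noteq> 0" using \<phi>(2)[OF n(3)] nz n(1) by simp
  then have "\<phi> $ n \<noteq> fps_const (\<phi> $ 0) $ n" using n(2) by simp
  then have nc: "\<phi> \<noteq> fps_const (\<phi> $ 0)" by metis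
  show ?thesis
  proof
    assume "\<exists>F :: 'a poly poly. F \<noteq> 0 \<and> poly2_eval F P Q = 0"
    then obtain F :: "'a poly poly" where F: "F \<noteq> 0" "poly2_eval F P Q = 0" by blast
    note Si = S_inv[OF ctx]
    have "poly2_eval F ?P' (dsym_diff ^ q) = 0"
      using conjugate_poly2_eval[OF Si(1,2), of F P Q] F(2) by (simp add: Si(3))
    with poly2_eval_neq_0_of_symbol[OF \<phi>(1) nc \<tau>(1) \<open>q > 0\<close> F(1)] show False by blast
  qed
qed

end
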